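(* Let $\beta>0$ and let $\mu_{\beta,0}$ be the unique Borel probability measure on $\Phi'$ with characteristic function $\int_{\Phi'}e^{i\langle v,u\rangle}\,d\mu_{\beta,0}(u)=e^{-\frac1{2\beta}\langle v,A^{-1}v\rangle}$. Then $\mu_{\beta,0}$ is a $(\beta,X)$-KMS state for the linear dynamical system given by the vector field $X=JA$.
   Context: $H$ is a separable real Hilbert space with inner product $\langle\cdot,\cdot\rangle$. $\Phi\subseteq H$ is a dense linear subspace which is a countably Hilbert nuclear space continuously embedded in $H$: a Fréchet space whose topology is given by an increasing sequence of compatible Hilbertian norms $\|\cdot\|_n$ such that, with $H_n$ the completion of $\Phi$ for $\|\cdot\|_n$, for every $n$ there is $m\ge n$ for which the embedding $H_m\to H_n$ is trace class (and $\Phi=\bigcap_nH_n$). Norms are compatible if a sequence in $\Phi$ that is Cauchy for both $\|\cdot\|_n$ and $\|\cdot\|_m$ tends to $0$ in $H_n$ iff it tends to $0$ in $H_m$. $\Phi'$ is the dual of $\Phi$ with respect to the inner product of $H$ ($\Phi\subseteq H\subseteq\Phi'$; $\langle\cdot,\cdot\rangle$ also denotes the duality pairing), with the weak-$*$ topology and its Borel $\sigma$-algebra. $J:H\to H$ is the bounded operator with $\sigma(u,v)=\langle u,Jv\rangle$, where $\sigma$ is a continuous non-degenerate antisymmetric bilinear form on $H$ (so $J^T=-J$); $J$ maps $\Phi$ continuously to itself and extends to $\Phi'$. $A:D(A)\subseteq H\to H$ is a positive symmetric (bounded or unbounded) operator with $A\ge c\,\mathds{1}$ for some $c>0$, $D(A)\supset\Phi$,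 $A$ invertible with bounded inverse. Characteristic function: the identity for $\mu_{\beta,0}$ is for $v\in\Phi$ (which determines the measure), and it holds for all $v\in H$ when, for $f\in H$, $\langle f,\cdot\rangle$ denotes the $L^2(\mu_{\beta,0})$-limit of $\langle f_n,\cdot\rangle$ for $f_n\in\Phi$, $f_n\to f$ in $H$. The vector field $X=JA$ is understood weakly: for $\varphi\in\Phi$, $\langle\varphi,X(u)\rangle=-\langle AJ\varphi,u\rangle$, with $AJ\varphi\in H$. Let $\{e_n\}_{n\in\mathbb{N}}\subset\Phi$ be a countable linearly independent set with $\mathrm{span}_{\mathbb{R}}\{e_j\}$ dense in $H$. $\mathscr{C}^\infty_{c,cyl}(\Phi')$ is the set of $F(u)=\varphi(\langle u,e_1\rangle,\dots,\langle u,e_n\rangle)$ with $n\in\mathbb{N}$, $\varphi\in\mathscr{C}^\infty_c(\mathbb{R}^n)$ real-valued; $\nabla F(u)=\sum_{j=1}^n\partial_j\varphi(\langle u,e_1\rangle,\dots,\langle u,e_n\rangle)e_j\in\Phi$; $\{F,G\}(u)=\langle\nabla F(u),J\nabla G(u)\rangle$. A Borel probability measure $\mu$ on $\Phi'$ is a $(\beta,X)$-KMS state if $\langle f,X(\cdot)\rangle$ is $\mu$-integrable for all $f\in\Phi$ and $\int\{F,G\}\,d\mu=\beta\int\langle\nabla F(u),X(u)\rangle\,G(u)\,d\mu$ for all $F,G\in\mathscr{C}^\infty_{c,cyl}(\Phi')$. *)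

theory Defs
  imports "HOL-Probability.Probability"
begin

section \<open>Hilbertian norms and completions\<close>

definition inner_product_on :: "'a::real_vector set \<Rightarrow> ('a \<Rightarrow> 'a \<Rightarrow> real) \<Rightarrow> bool" where
  "inner_product_on V b \<longleftrightarrow>
     (\<forall>x\<in>V. \<forall>y\<in>V. b x y = b y x) \<and>
     (\<forall>x\<in>V. \<forall>y\<in>V. \<forall>z\<in>V. b (x + y) z = b x z + b y z) \<and>
     (\<forall>c. \<forall>x\<in>V. \<forall>y\<in>V. b (c *\<^sub>R x) y = c * b x y) \<and>
     (\<forall>x\<in>V. x \<noteq> 0 \<longrightarrow> b x x > 0)"

definition ip_norm :: "('a \<Rightarrow> 'a \<Rightarrow> real) \<Rightarrow> 'a \<Rightarrow> real" where
  "ip_norm b x = sqrt (b x x)"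

definition cauchy_seqs :: "'a::real_vector set \<Rightarrow> ('a \<Rightarrow> 'a \<Rightarrow> real) \<Rightarrow> (nat \<Rightarrow> 'a) set" where
  "cauchy_seqs V b =
     {x. range x \<subseteq> V \<and> (\<forall>\<epsilon>>0. \<exists>N. \<forall>i\<ge>N. \<forall>j\<ge>N. ip_norm b (x i - x j) < \<epsilon>)}"

definition null_rel ::
    "'a::real_vector set \<Rightarrow> ('a \<Rightarrow> 'a \<Rightarrow> real) \<Rightarrow> ((nat \<Rightarrow> 'a) \<times> (nat \<Rightarrow> 'a)) set" where
  "null_rel V b = {(x, y). x \<in> cauchy_seqs V b \<and> y \<in> cauchy_seqs V b \<and>
                           (\<lambda>k. ip_norm b (x k - y k)) \<longlonglongrightarrow> 0}"

text \<open>The completion consists of the classes of Cauchy sequences modulo null sequences.  Its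
  Hilbert space operations are computed on representatives; they do not depend on the choice.\<close>

definition completion :: "'a::real_vector set \<Rightarrow> ('a \<Rightarrow> 'a \<Rightarrow> real) \<Rightarrow> (nat \<Rightarrow> 'a) set set" where
  "completion V b = cauchy_seqs V b // null_rel V b"

definition to_completion ::
    "'a::real_vector set \<Rightarrow> ('a \<Rightarrow> 'a \<Rightarrow> real) \<Rightarrow> 'a \<Rightarrow> (nat \<Rightarrow> 'a) set" where
  "to_completion V b v = null_rel V b `` {\<lambda>_. v}"

definition rep :: "(nat \<Rightarrow> 'a) set \<Rightarrow> nat \<Rightarrow> 'a" where
  "rep X = (SOME x. x \<in> X)"

definition cinner :: "('a \<Rightarrow> 'a \<Rightarrow> real) \<Rightarrow> (nat \<Rightarrow> 'a) set \<Rightarrow> (nat \<Rightarrow> 'a) set \<Rightarrow> real" where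
  "cinner b X Y = lim (\<lambda>k. b (rep X k) (rep Y k))"

definition cdist ::
    "('a::real_vector \<Rightarrow> 'a \<Rightarrow> real) \<Rightarrow> (nat \<Rightarrow> 'a) set \<Rightarrow> (nat \<Rightarrow> 'a) set \<Rightarrow> real" where
  "cdist b X Y = lim (\<lambda>k. ip_norm b (rep X k - rep Y k))"

definition clincomb :: "'a::real_vector set \<Rightarrow> ('a \<Rightarrow> 'a \<Rightarrow> real) \<Rightarrow> nat \<Rightarrow> (nat \<Rightarrow> real) \<Rightarrow>
    (nat \<Rightarrow> (nat \<Rightarrow> 'a) set) \<Rightarrow> (nat \<Rightarrow> 'a) set" where
  "clincomb V b K c Y = null_rel V b `` {\<lambda>k. \<Sum>j<K. c j *\<^sub>R rep (Y j) k}"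

text \<open>For a second inner product whose norm is dominated by that of the first one, the extension
  by continuity of the identity of \<open>V\<close> sends the class of a Cauchy sequence to the (coarser)
  class of the same sequence.  Here \<open>b\<close> is the inner product of the target space.\<close>

definition completion_embedding ::
    "'a::real_vector set \<Rightarrow> ('a \<Rightarrow> 'a \<Rightarrow> real) \<Rightarrow> (nat \<Rightarrow> 'a) set \<Rightarrow> (nat \<Rightarrow> 'a) set" where
  "completion_embedding V b X = null_rel V b `` X"

definition orthonormal_family ::
    "('a \<Rightarrow> 'a \<Rightarrow> real) \<Rightarrow> nat set \<Rightarrow> (nat \<Rightarrow> (nat \<Rightarrow> 'a) set) \<Rightarrow> bool" where
  "orthonormal_family b I E \<longleftrightarrow>
     (\<forall>j\<in>I. \<forall>k\<in>I. cinner b (E j) (E k) = (if j = k then 1 else 0))"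

text \<open>Trace class operators between two Hilbert spaces: \<open>T x = \<Sum>\<^sub>j \<lambda>\<^sub>j \<langle>x, E\<^sub>j\<rangle> G\<^sub>j\<close> with summable
  singular values \<open>\<lambda>\<^sub>j\<close> and orthonormal systems \<open>E\<close>, \<open>G\<close> in the source and the target.  Indices
  with \<open>\<lambda>\<^sub>j = 0\<close> are ignored, which accommodates operators of finite rank.\<close>

definition trace_class ::
    "'a::real_vector set \<Rightarrow> ('a \<Rightarrow> 'a \<Rightarrow> real) \<Rightarrow> ('a \<Rightarrow> 'a \<Rightarrow> real) \<Rightarrow>
     ((nat \<Rightarrow> 'a) set \<Rightarrow> (nat \<Rightarrow> 'a) set) \<Rightarrow> bool" where
  "trace_class V b b' T \<longleftrightarrow>
     (\<exists>s E G. (\<forall>j. 0 \<le> s j) \<and> summable s \<and>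
        (\<forall>j. E j \<in> completion V b) \<and> (\<forall>j. G j \<in> completion V b') \<and>
        orthonormal_family b {j. 0 < s j} E \<and> orthonormal_family b' {j. 0 < s j} G \<and>
        (\<forall>X \<in> completion V b.
           (\<lambda>K. cdist b' (T X) (clincomb V b' K (\<lambda>j. s j * cinner b X (E j)) G)) \<longlonglongrightarrow> 0))"

section \<open>Countably Hilbert nuclear spaces and their duals\<close>

definition compatible_norms ::
    "'a::real_vector set \<Rightarrow> ('a \<Rightarrow> 'a \<Rightarrow> real) \<Rightarrow> ('a \<Rightarrow> 'a \<Rightarrow> real) \<Rightarrow> bool" where
  "compatible_norms V b b' \<longleftrightarrow>
     (\<forall>x \<in> cauchy_seqs V b \<inter> cauchy_seqs V b'.
        (\<lambda>k. ip_norm b (x k)) \<longlonglongrightarrow> 0 \<longleftrightarrow> (\<lambda>k. ip_norm b' (x k)) \<longlonglongrightarrow> 0)"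

definition countably_normed_topology ::
    "'a::real_vector set \<Rightarrow> (nat \<Rightarrow> 'a \<Rightarrow> 'a \<Rightarrow> real) \<Rightarrow> 'a topology" where
  "countably_normed_topology V ip = topology_generated_by
     {B. \<exists>n. \<exists>x\<in>V. \<exists>\<epsilon>>0. B = {y \<in> V. ip_norm (ip n) (y - x) < \<epsilon>}}"

text \<open>The last condition says that \<open>V\<close> is the intersection of the completions, an element of the
  intersection being a family of elements that correspond to each other under the embeddings.\<close>

definition countably_Hilbert_nuclear ::
    "'a::real_vector set \<Rightarrow> (nat \<Rightarrow> 'a \<Rightarrow> 'a \<Rightarrow> real) \<Rightarrow> bool" where
  "countably_Hilbert_nuclear V ip \<longleftrightarrow>
     subspace V \<and>
     (\<forall>n. inner_product_on V (ip n)) \<and>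
     (\<forall>n. \<forall>x\<in>V. ip_norm (ip n) x \<le> ip_norm (ip (Suc n)) x) \<and>
     (\<forall>n m. compatible_norms V (ip n) (ip m)) \<and>
     (\<forall>x. (\<forall>n. x \<in> cauchy_seqs V (ip n)) \<longrightarrow>
        (\<exists>l\<in>V. \<forall>n. (\<lambda>k. ip_norm (ip n) (x k - l)) \<longlonglongrightarrow> 0)) \<and>
     (\<forall>n. \<exists>m\<ge>n. trace_class V (ip m) (ip n) (completion_embedding V (ip n))) \<and>
     (\<forall>X. (\<forall>n. X n \<in> completion V (ip n)) \<and>
          (\<forall>n m. n \<le> m \<longrightarrow> completion_embedding V (ip n) (X m) = X n) \<longrightarrow>
        (\<exists>v\<in>V. \<forall>n. X n = to_completion V (ip n) v))"

text \<open>An element \<open>u\<close> of the dual is a function on \<open>V\<close> (undefined outside \<open>V\<close>), and \<open>u v\<close> is the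
  duality pairing \<open>\<langle>v, u\<rangle>\<close>.  A vector \<open>h\<close> of the ambient Hilbert space is identified with the
  functional \<open>v \<mapsto> \<langle>v, h\<rangle>\<close>.\<close>

definition dual_space ::
    "'a::real_vector set \<Rightarrow> (nat \<Rightarrow> 'a \<Rightarrow> 'a \<Rightarrow> real) \<Rightarrow> ('a \<Rightarrow> real) set" where
  "dual_space V ip =
     {u \<in> extensional V.
        (\<forall>x\<in>V. \<forall>y\<in>V. u (x + y) = u x + u y) \<and>
        (\<forall>c. \<forall>x\<in>V. u (c *\<^sub>R x) = c * u x) \<and>
        continuous_map (countably_normed_topology V ip) euclideanreal u}"

definition weak_star_topology ::
    "'a::real_vector set \<Rightarrow> (nat \<Rightarrow> 'a \<Rightarrow> 'a \<Rightarrow> real) \<Rightarrow> ('a \<Rightarrow> real) topology" where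
  "weak_star_topology V ip = subtopology (powertop_real V) (dual_space V ip)"

definition borel_of :: "'a topology \<Rightarrow> 'a measure" where
  "borel_of T = sigma (topspace T) {U. openin T U}"

definition borel_prob_on_dual ::
    "'a::real_vector set \<Rightarrow> (nat \<Rightarrow> 'a \<Rightarrow> 'a \<Rightarrow> real) \<Rightarrow> ('a \<Rightarrow> real) measure \<Rightarrow> bool" where
  "borel_prob_on_dual V ip \<mu> \<longleftrightarrow>
     prob_space \<mu> \<and> sets \<mu> = sets (borel_of (weak_star_topology V ip))"

section \<open>Cylindrical test functions\<close>

definition partial :: "nat \<Rightarrow> ((nat \<Rightarrow> real) \<Rightarrow> real) \<Rightarrow> (nat \<Rightarrow> real) \<Rightarrow> real" where
  "partial i \<phi> x = deriv (\<lambda>t. \<phi> (x(i := t))) (x i)"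

text \<open>Functions on \<open>\<real>\<^sup>n\<close>, i.e. on the topological space \<open>Euclidean_space n\<close> of sequences supported
  in \<open>{..<n}\<close>; the values elsewhere are irrelevant.  Smoothness means that all iterated
  partial derivatives exist and are continuous.\<close>

definition smooth_compact_support :: "nat \<Rightarrow> ((nat \<Rightarrow> real) \<Rightarrow> real) \<Rightarrow> bool" where
  "smooth_compact_support n \<phi> \<longleftrightarrow>
     (\<forall>is. set is \<subseteq> {..<n} \<longrightarrow>
        continuous_map (Euclidean_space n) euclideanreal (fold partial is \<phi>) \<and>
        (\<forall>i<n. \<forall>x\<in>topspace (Euclidean_space n).
           (\<lambda>t. fold partial is \<phi> (x(i := t))) differentiable at (x i))) \<and>
     compactin (Euclidean_space n)
       (Euclidean_space n closure_of {x \<in> topspace (Euclidean_space n). \<phi> x \<noteq> 0})"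

definition coords :: "(nat \<Rightarrow> 'a) \<Rightarrow> nat \<Rightarrow> ('a \<Rightarrow> real) \<Rightarrow> nat \<Rightarrow> real" where
  "coords e n u = (\<lambda>i. if i < n then u (e i) else 0)"

definition cyl :: "(nat \<Rightarrow> 'a) \<Rightarrow> nat \<Rightarrow> ((nat \<Rightarrow> real) \<Rightarrow> real) \<Rightarrow> ('a \<Rightarrow> real) \<Rightarrow> real" where
  "cyl e n \<phi> u = \<phi> (coords e n u)"

definition cyl_grad ::
    "(nat \<Rightarrow> 'a::real_vector) \<Rightarrow> nat \<Rightarrow> ((nat \<Rightarrow> real) \<Rightarrow> real) \<Rightarrow> ('a \<Rightarrow> real) \<Rightarrow> 'a" where
  "cyl_grad e n \<phi> u = (\<Sum>j<n. partial j \<phi> (coords e n u) *\<^sub>R e j)"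

definition poisson :: "('a::real_inner \<Rightarrow> 'a) \<Rightarrow> (nat \<Rightarrow> 'a) \<Rightarrow>
    nat \<Rightarrow> ((nat \<Rightarrow> real) \<Rightarrow> real) \<Rightarrow> nat \<Rightarrow> ((nat \<Rightarrow> real) \<Rightarrow> real) \<Rightarrow> ('a \<Rightarrow> real) \<Rightarrow> real" where
  "poisson J e n \<phi> m \<psi> u = inner (cyl_grad e n \<phi> u) (J (cyl_grad e m \<psi> u))"

section \<open>Weak vector fields and KMS states\<close>

text \<open>A vector field \<open>X\<close> that is only understood weakly is given by the functions
  \<open>W f = \<langle>f, X(\<cdot>)\<rangle>\<close> for \<open>f\<close> in \<open>V\<close>, each of them being determined up to null sets only.
  Hence \<open>\<langle>\<nabla>F(u), X(u)\<rangle>\<close> is expanded along the vectors \<open>e j\<close>; the lemma below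
  shows that this is the plain pairing for a vector field with pointwise values.\<close>

definition grad_field_pairing :: "('a \<Rightarrow> ('a \<Rightarrow> real) \<Rightarrow> real) \<Rightarrow> (nat \<Rightarrow> 'a) \<Rightarrow>
    nat \<Rightarrow> ((nat \<Rightarrow> real) \<Rightarrow> real) \<Rightarrow> ('a \<Rightarrow> real) \<Rightarrow> real" where
  "grad_field_pairing W e n \<phi> u = (\<Sum>j<n. partial j \<phi> (coords e n u) * W (e j) u)"

lemma grad_field_pairing_pointwise:
  fixes X :: "('a::real_vector \<Rightarrow> real) \<Rightarrow> 'a \<Rightarrow> real"
  assumes "subspace V" and "range e \<subseteq> V" and "X u \<in> dual_space V ip"
  shows "grad_field_pairing (\<lambda>f u. X u f) e n \<phi> u = X u (cyl_grad e n \<phi> u)"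
proof -
  have add: "X u (x + y) = X u x + X u y" if "x \<in> V" "y \<in> V" for x y
    using assms(3) that by (auto simp: dual_space_def)
  have scale: "X u (c *\<^sub>R x) = c * X u x" if "x \<in> V" for c x
    using assms(3) that by (auto simp: dual_space_def)
  have eV: "e j \<in> V" for j
    using assms(2) by auto
  have zero: "X u 0 = 0"
    using scale[of 0 0] subspace_0[OF assms(1)] by simp
  have "X u (\<Sum>j<k. c j *\<^sub>R e j) = (\<Sum>j<k. c j * X u (e j))" for k and c :: "nat \<Rightarrow> real"
  proof (induction k)
    case 0
    then show ?case by (simp add: zero)
  next
    case (Suc k)
    have "(\<Sum>j<k. c j *\<^sub>R e j) \<in> V"
      using assms(1) eV by (intro subspace_sum subspace_scale) auto
    then show ?case
      using Suc eV assms(1) by (simp add: add scale subspace_scale)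
  qed
  then show ?thesis
    by (simp add: grad_field_pairing_def cyl_grad_def)
qed

definition kms_state ::
    "'a::real_inner set \<Rightarrow> (nat \<Rightarrow> 'a \<Rightarrow> 'a \<Rightarrow> real) \<Rightarrow> ('a \<Rightarrow> 'a) \<Rightarrow> (nat \<Rightarrow> 'a) \<Rightarrow>
     real \<Rightarrow> ('a \<Rightarrow> ('a \<Rightarrow> real) \<Rightarrow> real) \<Rightarrow> ('a \<Rightarrow> real) measure \<Rightarrow> bool" where
  "kms_state V ip J e \<beta> W \<mu> \<longleftrightarrow>
     borel_prob_on_dual V ip \<mu> \<and>
     (\<forall>f\<in>V. integrable \<mu> (W f)) \<and>
     (\<forall>n m \<phi> \<psi>. 0 < n \<and> 0 < m \<and> smooth_compact_support n \<phi> \<and> smooth_compact_support m \<psi> \<longrightarrow>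
        (\<integral>u. poisson J e n \<phi> m \<psi> u \<partial>\<mu>) =
        \<beta> * (\<integral>u. grad_field_pairing W e n \<phi> u * cyl e m \<psi> u \<partial>\<mu>))"

text \<open>\<open>\<langle>f, \<cdot>\<rangle>\<close> for \<open>f\<close> in the Hilbert space: a version of the limit in \<open>L\<^sup>2(\<mu>)\<close> of
  \<open>\<langle>f\<^sub>k, \<cdot>\<rangle>\<close> as \<open>f\<^sub>k\<close> in \<open>V\<close> tends to \<open>f\<close>.\<close>

definition is_L2_pairing ::
    "'a::real_normed_vector set \<Rightarrow> ('a \<Rightarrow> real) measure \<Rightarrow> 'a \<Rightarrow> (('a \<Rightarrow> real) \<Rightarrow> real) \<Rightarrow> bool" where
  "is_L2_pairing V \<mu> f g \<longleftrightarrow>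
     g \<in> borel_measurable \<mu> \<and> integrable \<mu> (\<lambda>u. (g u)\<^sup>2) \<and>
     (\<forall>x. range x \<subseteq> V \<and> x \<longlonglongrightarrow> f \<longrightarrow>
        (\<lambda>k. \<integral>\<^sup>+ u. ennreal ((u (x k) - g u)\<^sup>2) \<partial>\<mu>) \<longlonglongrightarrow> 0)"

definition L2_pairing ::
    "'a::real_normed_vector set \<Rightarrow> ('a \<Rightarrow> real) measure \<Rightarrow> 'a \<Rightarrow> ('a \<Rightarrow> real) \<Rightarrow> real" where
  "L2_pairing V \<mu> f = (SOME g. is_L2_pairing V \<mu> f g)"

text \<open>The vector field \<open>X = J A\<close>, by \<open>\<langle>f, X(u)\<rangle> = - \<langle>A J f, u\<rangle>\<close>.\<close>

definition JA_field :: "'a::real_normed_vector set \<Rightarrow> ('a \<Rightarrow> real) measure \<Rightarrow>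
    ('a \<Rightarrow> 'a) \<Rightarrow> ('a \<Rightarrow> 'a) \<Rightarrow> 'a \<Rightarrow> ('a \<Rightarrow> real) \<Rightarrow> real" where
  "JA_field V \<mu> J A f u = - L2_pairing V \<mu> (A (J f)) u"

definition symplectic_form :: "('a::real_normed_vector \<Rightarrow> 'a \<Rightarrow> real) \<Rightarrow> bool" where
  "symplectic_form \<sigma> \<longleftrightarrow>
     bounded_bilinear \<sigma> \<and> (\<forall>u v. \<sigma> u v = - \<sigma> v u) \<and> (\<forall>u. (\<forall>v. \<sigma> u v = 0) \<longrightarrow> u = 0)"

definition positive_invertible_operator ::
    "'a::real_inner set \<Rightarrow> ('a \<Rightarrow> 'a) \<Rightarrow> bool" where
  "positive_invertible_operator D A \<longleftrightarrow>
     subspace D \<and>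
     (\<forall>x\<in>D. \<forall>y\<in>D. A (x + y) = A x + A y) \<and>
     (\<forall>c. \<forall>x\<in>D. A (c *\<^sub>R x) = c *\<^sub>R A x) \<and>
     (\<forall>x\<in>D. \<forall>y\<in>D. inner (A x) y = inner x (A y)) \<and>
     (\<exists>c>0. \<forall>x\<in>D. c * inner x x \<le> inner x (A x)) \<and>
     bij_betw A D UNIV \<and> bounded_linear (inv_into D A)"

end

theory Submission
  imports Defs "HOL-Real_Asymp.Real_Asymp"
begin

text \<open>The measure is Gaussian with covariance \<open>\<langle>v, A\<^sup>-\<^sup>1 w\<rangle> / \<beta>\<close>, so everything follows from
  Gaussian integration by parts,
  \<open>\<integral> \<langle>g, u\<rangle> H(u) d\<mu> = \<Sum>\<^sub>i (\<langle>g, A\<^sup>-\<^sup>1 e\<^sub>i\<rangle> / \<beta>) \<integral> \<partial>\<^sub>i H d\<mu>\<close>, with \<open>g = A J e\<^sub>j\<close> and \<open>H = \<partial>\<^sub>j \<phi> \<psi>\<close>: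
  the terms containing \<open>\<partial>\<^sub>i \<partial>\<^sub>j \<phi>\<close> cancel because \<open>J\<close> is skew, and the rest is the Poisson bracket.

  Integration by parts holds for \<open>H\<close> a trigonometric polynomial by differentiating the
  characteristic function.  To reach compactly supported \<open>H\<close> without approximating derivatives, it is
  put into the integrated form \<open>\<integral> (H(u + t C) - H(u)) = \<integral>\<^sub>0\<^sup>t \<integral> X H(u + s C) ds\<close>, where \<open>X = \<langle>g, u\<rangle>\<close> and
  \<open>C\<^sub>i\<close> is the covariance of \<open>X\<close> with the \<open>i\<close>-th coordinate.  This form is stable under bounded pointwise
  convergence, and such approximations are provided by the Stone-Weierstrass theorem on a torus.\<close>

section \<open>Approximation by trigonometric polynomials\<close>

text \<open>The phase \<open>b\<close> makes sines and constants special cases, and arbitrary real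
  frequencies let one set serve all periods.\<close>

inductive_set trig_poly :: "nat \<Rightarrow> ((nat \<Rightarrow> real) \<Rightarrow> real) set" for N where
  base: "(\<lambda>y. a * cos ((\<Sum>i<N. w i * y i) + b)) \<in> trig_poly N"
| add: "f \<in> trig_poly N \<Longrightarrow> g \<in> trig_poly N \<Longrightarrow> (\<lambda>y. f y + g y) \<in> trig_poly N"

lemma trig_poly_const: "(\<lambda>_. c) \<in> trig_poly N"
  using trig_poly.base[of c "\<lambda>_. 0" N 0] by simp

lemma trig_poly_mult_base:
  assumes "g \<in> trig_poly N"
  shows "(\<lambda>y. (a * cos ((\<Sum>i<N. w i * y i) + b)) * g y) \<in> trig_poly N"
  using assms
proof induction
  case (base a' w' b')
  have "(\<lambda>y. (a * cos ((\<Sum>i<N. w i * y i) + b)) * (a' * cos ((\<Sum>i<N. w' i * y i) + b'))) =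
    (\<lambda>y. a * a' / 2 * cos ((\<Sum>i<N. (w i - w' i) * y i) + (b - b'))
       + a * a' / 2 * cos ((\<Sum>i<N. (w i + w' i) * y i) + (b + b')))" (is "?l = ?r")
  proof
    fix y :: "nat \<Rightarrow> real"
    have prod: "cos p * cos q = (cos (p - q) + cos (p + q)) / 2" for p q :: real
      by (rule cos_times_cos)
    have "((\<Sum>i<N. w i * y i) + b) - ((\<Sum>i<N. w' i * y i) + b') = (\<Sum>i<N. (w i - w' i) * y i) + (b - b')"
      "((\<Sum>i<N. w i * y i) + b) + ((\<Sum>i<N. w' i * y i) + b') = (\<Sum>i<N. (w i + w' i) * y i) + (b + b')"
      by (simp_all add: sum.distrib sum_subtractf distrib_right left_diff_distrib)
    then show "?l y = ?r y"
      using prod[of "(\<Sum>i<N. w i * y i) + b" "(\<Sum>i<N. w' i * y i) + b'"] by (simp add: field_simps)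
  qed
  then show ?case
    by (simp only:) (intro trig_poly.add trig_poly.base)
next
  case (add f g)
  then show ?case
    using trig_poly.add[OF add.IH] by (simp add: distrib_left)
qed

text \<open>Product-to-sum for cosines makes the set an algebra, as Stone-Weierstrass
  requires.\<close>

lemma trig_poly_mult:
  assumes "f \<in> trig_poly N" "g \<in> trig_poly N"
  shows "(\<lambda>y. f y * g y) \<in> trig_poly N"
  using assms(1)
proof induction
  case (base a w b)
  then show ?case by (rule trig_poly_mult_base[OF assms(2)])
next
  case (add f f')
  then show ?case
    using trig_poly.add[OF add.IH] by (simp add: distrib_right)
qed

section \<open>Bounded pointwise approximation of functions supported in a box\<close>

lemma compact_PiE_UNIV:
  fixes S :: "'i \<Rightarrow> 'b::topological_space set"
  assumes "\<And>i. compact (S i)"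
  shows "compact {x. \<forall>i. x i \<in> S i}"
proof -
  have "compactin (product_topology (\<lambda>i. euclidean) UNIV) (PiE UNIV S)"
    using assms by (simp add: compactin_PiE)
  moreover have "PiE UNIV S = {x. \<forall>i. x i \<in> S i}"
    by (auto simp: PiE_def Pi_def)
  ultimately show ?thesis
    by (simp add: euclidean_product_topology)
qed

lemma continuous_on_trig_poly: "P \<in> trig_poly N \<Longrightarrow> continuous_on UNIV P"
  by (induction rule: trig_poly.induct) (auto intro!: continuous_intros)

lemma trig_poly_bounded: "P \<in> trig_poly N \<Longrightarrow> \<exists>B. \<forall>y. \<bar>P y\<bar> \<le> B"
proof (induction rule: trig_poly.induct)
  case (base a w b)
  have "\<bar>a * cos ((\<Sum>i<N. w i * y i) + b)\<bar> \<le> \<bar>a\<bar>" for y :: "nat \<Rightarrow> real"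
    unfolding abs_mult by (rule mult_left_le) auto
  then show ?case by blast
next
  case (add f g)
  then obtain B B' where "\<forall>y. \<bar>f y\<bar> \<le> B" "\<forall>y. \<bar>g y\<bar> \<le> B'" by auto
  then have "\<forall>y. \<bar>f y + g y\<bar> \<le> B + B'"
    by (meson abs_triangle_ineq add_mono order_trans)
  then show ?case by blast
qed

text \<open>Functions on \<real>^N supported in a cube are modelled by functions of whole sequences.
  Functions of different numbers of variables then share one type and can be multiplied, and
  continuity is that of the product topology.\<close>

definition box_supported :: "nat \<Rightarrow> real \<Rightarrow> ((nat \<Rightarrow> real) \<Rightarrow> real) \<Rightarrow> bool" where
  "box_supported N R H \<longleftrightarrow> continuous_on UNIV H \<and>
     (\<forall>y z. (\<forall>i<N. y i = z i) \<longrightarrow> H y = H z) \<and> (\<forall>y. (\<exists>i<N. \<bar>y i\<bar> > R) \<longrightarrow> H y = 0)"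

lemma box_supportedD:
  assumes "box_supported N R H"
  shows "continuous_on UNIV H" "(\<And>i. i < N \<Longrightarrow> y i = z i) \<Longrightarrow> H y = H z"
    "i < N \<Longrightarrow> \<bar>y i\<bar> > R \<Longrightarrow> H y = 0"
  using assms by (auto simp: box_supported_def)

lemma box_supported_bounded:
  fixes H :: "(nat \<Rightarrow> real) \<Rightarrow> real"
  assumes H: "box_supported N R H"
  shows "\<exists>B. \<forall>y. \<bar>H y\<bar> \<le> B"
proof -
  note cont = box_supportedD(1)[OF H] and dep = box_supportedD(2)[OF H] and supp = box_supportedD(3)[OF H]
  let ?K = "{y :: nat \<Rightarrow> real. \<forall>i. y i \<in> (if i < N then {-R..R} else {0})}"
  have "compact ?K"
    by (rule compact_PiE_UNIV) auto
  then have "bounded (H ` ?K)"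
    using cont by (intro compact_imp_bounded compact_continuous_image) (auto intro: continuous_on_subset)
  then obtain B where B: "\<And>y. y \<in> ?K \<Longrightarrow> \<bar>H y\<bar> \<le> B"
    by (auto simp: bounded_iff)
  \<comment> \<open>For negative \<open>R\<close> the set \<open>?K\<close> can be empty and
    \<open>B\<close> negative; the maximum with 0 then covers the points where \<open>H\<close>
    vanishes.\<close>
  have "\<bar>H y\<bar> \<le> max B 0" for y
  proof (cases "\<forall>i<N. \<bar>y i\<bar> \<le> R")
    case True
    then have "(\<lambda>i. if i < N then y i else 0) \<in> ?K"
      by (auto simp: abs_le_iff)
    moreover have "H y = H (\<lambda>i. if i < N then y i else 0)"
      by (rule dep) simp
    ultimately show ?thesis using B by force
  next
    case False
    then obtain i where "i < N" "\<bar>y i\<bar> > R" by (auto simp: not_le)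
    then show ?thesis using supp[of i y] by simp
  qed
  then show ?thesis by blast
qed

text \<open>Winding each coordinate around a circle by \<open>cis (s * y i)\<close> moves the
  problem to a compact torus, where polynomials in the real and imaginary parts pull back to
  trigonometric polynomials. The approximant is periodic, so closeness to \<open>H\<close> is
  claimed only for angles up to \<open>pi / 2\<close>, while the bound holds everywhere. Since
  \<open>s * R \<le> 1\<close>, the support of \<open>H\<close> occupies angles at most 1.\<close>

lemma trig_poly_approx_scaled:
  fixes H :: "(nat \<Rightarrow> real) \<Rightarrow> real"
  assumes H: "box_supported N R H"
    and bdd: "\<And>y. \<bar>H y\<bar> \<le> B"
    and s: "s > 0" "s * R \<le> 1" and \<epsilon>: "\<epsilon> > 0"
  shows "\<exists>P \<in> trig_poly N. (\<forall>y. \<bar>P y\<bar> \<le> B + \<epsilon>) \<and>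
           (\<forall>y. (\<forall>i<N. \<bar>s * y i\<bar> \<le> pi / 2) \<longrightarrow> \<bar>P y - H y\<bar> \<le> \<epsilon>)"
proof -
  note cont = box_supportedD(1)[OF H] and dep = box_supportedD(2)[OF H] and supp = box_supportedD(3)[OF H]
  \<comment> \<open>The periodic extension \<open>Ht\<close> of \<open>H\<close> is continuous on the torus: the factors \<open>cut\<close> kill the
    part of the circle on which \<open>arcsin \<circ> Im\<close> is not the angle.\<close>
  define cut :: "real \<Rightarrow> real" where "cut c = min 1 (max 0 (c / cos 1))" for c
  define Ht where "Ht z = H (\<lambda>i. arcsin (Im (z i)) / s) * (\<Prod>i<N. cut (Re (z i)))" for z :: "nat \<Rightarrow> complex"
  \<comment> \<open>Coordinates from \<open>N\<close> on are pinned to 0, so that \<open>T\<close>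
    is an \<open>N\<close>-dimensional torus inside a function type.\<close>
  define T where "T = {z :: nat \<Rightarrow> complex. \<forall>i. z i \<in> (if i < N then sphere 0 1 else {0})}"
  define tor where "tor y = (\<lambda>i. if i < N then cis (s * y i) else 0)" for y :: "nat \<Rightarrow> real"
  \<comment> \<open>With the pullback condition built into the ring, whatever Stone-Weierstrass
    returns is a trigonometric polynomial.\<close>
  define Rg where "Rg = {f. continuous_on T f \<and> (\<lambda>y. f (tor y)) \<in> trig_poly N}"
  have cos1: "cos (1::real) > 0"
    using cos_gt_zero_pi[of 1] pi_gt3 by simp
  have tor_T: "tor y \<in> T" for y
    by (auto simp: T_def tor_def)
  have coord: "continuous_on T (\<lambda>z. z i)" for i
    by (rule continuous_on_subset[OF continuous_on_product_coordinates]) simp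
  have T_bd: "\<bar>Im (z i)\<bar> \<le> 1" if "z \<in> T" for z i
  proof -
    have "cmod (z i) \<le> 1" using that by (auto simp: T_def split: if_splits dest!: spec[of _ i])
    then show ?thesis using abs_Im_le_cmod[of "z i"] by linarith
  qed
  interpret function_ring_on Rg T
  proof
    show "compact T" unfolding T_def by (rule compact_PiE_UNIV) auto
  next
    fix x y assume xy: "x \<in> T" "y \<in> T" "x \<noteq> y"
    then obtain i where i: "x i \<noteq> y i" by auto
    then have iN: "i < N" using xy by (auto simp: T_def split: if_splits dest!: spec[of _ i])
    have w: "(\<Sum>j<N. (if j = i then s else 0) * v j) = s * v i" for v :: "nat \<Rightarrow> real"
      using iN by (simp add: if_distrib[of "\<lambda>c. c * _"] cong: if_cong)
    \<comment> \<open>Real and imaginary parts of the coordinates separate points; a sine is a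
      cosine with phase \<open>-pi/2\<close>.\<close>
    have "(\<lambda>z. Re (z i)) \<in> Rg"
      using trig_poly.base[of 1 "\<lambda>j. if j = i then s else 0" N 0] iN w
      by (auto simp: Rg_def tor_def intro!: continuous_intros coord)
    moreover have "(\<lambda>z. Im (z i)) \<in> Rg"
      using trig_poly.base[of 1 "\<lambda>j. if j = i then s else 0" N "-pi/2"] iN w
      by (auto simp: Rg_def tor_def cos_diff intro!: continuous_intros coord)
    moreover have "Re (x i) \<noteq> Re (y i) \<or> Im (x i) \<noteq> Im (y i)"
      using i by (simp add: complex_eq_iff)
    ultimately show "\<exists>f\<in>Rg. f x \<noteq> f y"
      by (elim disjE) (rule bexI[rotated], assumption, simp)+
  next
    show "(\<lambda>x. f x + g x) \<in> Rg" if "f \<in> Rg" "g \<in> Rg" for f g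
      using that trig_poly.add[of "\<lambda>y. f (tor y)" N "\<lambda>y. g (tor y)"]
      by (simp add: Rg_def continuous_on_add)
    show "(\<lambda>x. f x * g x) \<in> Rg" if "f \<in> Rg" "g \<in> Rg" for f g
      using that trig_poly_mult[of "\<lambda>y. f (tor y)" N "\<lambda>y. g (tor y)"]
      by (simp add: Rg_def continuous_on_mult)
  qed (simp_all add: Rg_def trig_poly_const)
  have "continuous_on T Ht"
    unfolding Ht_def cut_def
  proof (intro continuous_on_mult continuous_on_prod continuous_on_min continuous_on_max continuous_on_divide
      continuous_on_const continuous_on_Re coord continuous_on_compose2[OF cont] continuous_on_coordinatewise_then_product
      continuous_on_arcsin continuous_on_Im)
  qed (use T_bd s cos1 in \<open>auto simp: abs_le_iff minus_le_iff\<close>)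
  from Stone_Weierstrass_basic[OF this \<epsilon>] obtain g where g: "g \<in> Rg" "\<And>z. z \<in> T \<Longrightarrow> \<bar>Ht z - g z\<bar> < \<epsilon>"
    by auto
  have "\<bar>Ht z\<bar> \<le> B" for z
  proof -
    have "\<bar>\<Prod>i<N. cut (Re (z i))\<bar> \<le> 1"
      unfolding abs_prod by (rule prod_le_1) (auto simp: cut_def)
    then show ?thesis
      unfolding Ht_def abs_mult using bdd[of "\<lambda>i. arcsin (Im (z i)) / s"]
      by (meson abs_ge_zero mult_left_le order_trans)
  qed
  note Ht_bdd = this
  have 1: "\<bar>g (tor y)\<bar> \<le> B + \<epsilon>" for y
  proof -
    have "\<bar>Ht (tor y)\<bar> \<le> B" by (rule Ht_bdd)
    then show ?thesis using g(2)[OF tor_T[of y]] by linarith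
  qed
  have 2: "\<bar>g (tor y) - H y\<bar> \<le> \<epsilon>" if y: "\<forall>i<N. \<bar>s * y i\<bar> \<le> pi / 2" for y
  proof -
    have "arcsin (Im (tor y i)) / s = y i" if i: "i < N" for i
    proof -
      have "\<bar>s * y i\<bar> \<le> pi / 2" using y i by blast
      then have "arcsin (sin (s * y i)) = s * y i" by (intro arcsin_sin) linarith+
      then show ?thesis using i s by (simp add: tor_def)
    qed
    then have H: "H (\<lambda>i. arcsin (Im (tor y i)) / s) = H y"
      by (intro dep) auto
    have "Ht (tor y) = H y"
    \<comment> \<open>Inside the cube the cutoff equals 1; outside it \<open>H\<close> vanishes,
      whatever the cutoff is.\<close>
    proof (cases "\<forall>i<N. \<bar>y i\<bar> \<le> R")
      case True
      have "cut (Re (tor y i)) = 1" if i: "i < N" for i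
      proof -
        have "s * \<bar>y i\<bar> \<le> s * R"
          using True i s(1) by (intro mult_left_mono) auto
        then have "\<bar>s * y i\<bar> \<le> 1"
          using s by (simp only: abs_mult abs_of_pos order_trans[OF _ s(2)])
        \<comment> \<open>\<open>cos 1\<close> is the level from which \<open>cut\<close> equals
          1.\<close>
        then have "cos 1 \<le> cos \<bar>s * y i\<bar>"
          using pi_gt3 by (intro cos_monotone_0_pi_le) auto
        then show ?thesis
          using i cos1 by (simp add: cut_def tor_def)
      qed
      then show ?thesis by (simp add: Ht_def H)
    next
      case False
      then obtain i where "i < N" "\<bar>y i\<bar> > R" by (auto simp: not_le)
      then show ?thesis using supp[of i y] by (simp add: Ht_def H)
    qed
    then show ?thesis using g(2)[OF tor_T[of y]] by (simp add: abs_minus_commute)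
  qed
  show ?thesis
    using g(1) 1 2 by (intro bexI[of _ "\<lambda>y. g (tor y)"]) (auto simp: Rg_def)
qed

text \<open>As the scale tends to 0, the windows of good approximation exhaust the whole space. The
  common bound prepares for dominated convergence.\<close>

lemma trig_poly_approx:
  fixes H :: "(nat \<Rightarrow> real) \<Rightarrow> real"
  assumes H: "box_supported N R H"
  obtains P B where "\<And>k. P k \<in> trig_poly N" "\<And>k y. \<bar>P k y\<bar> \<le> B" "\<And>y. \<bar>H y\<bar> \<le> B"
    "\<And>y. (\<lambda>k::nat. P k y) \<longlonglongrightarrow> H y"
proof -
  obtain B where B: "\<And>y. \<bar>H y\<bar> \<le> B"
    using box_supported_bounded[OF H] by auto
  \<comment> \<open>The denominator exceeds \<open>\<bar>R\<bar>\<close>, which keeps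
    \<open>s k * R \<le> 1\<close> while \<open>s k\<close> tends to 0.\<close>
  define s where "s k = 1 / (\<bar>R\<bar> + 1 + real k)" for k
  define \<epsilon> where "\<epsilon> k = 1 / real (Suc k)" for k
  have s: "s k > 0" "s k * R \<le> 1" for k
    by (auto simp: s_def field_simps)
  have \<epsilon>: "\<epsilon> k > 0" "\<epsilon> k \<le> 1" for k by (auto simp: \<epsilon>_def)
  have "\<forall>k. \<exists>P. P \<in> trig_poly N \<and> (\<forall>y. \<bar>P y\<bar> \<le> B + \<epsilon> k) \<and>
           (\<forall>y. (\<forall>i<N. \<bar>s k * y i\<bar> \<le> pi / 2) \<longrightarrow> \<bar>P y - H y\<bar> \<le> \<epsilon> k)"
    using trig_poly_approx_scaled[OF H B s \<epsilon>(1)] by (simp add: Bex_def)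
  then obtain P where P: "\<And>k. P k \<in> trig_poly N" "\<And>k y. \<bar>P k y\<bar> \<le> B + \<epsilon> k"
      "\<And>k y. (\<forall>i<N. \<bar>s k * y i\<bar> \<le> pi / 2) \<Longrightarrow> \<bar>P k y - H y\<bar> \<le> \<epsilon> k"
    by metis
  have s0: "s \<longlonglongrightarrow> 0" unfolding s_def by real_asymp
  have \<epsilon>0: "\<epsilon> \<longlonglongrightarrow> 0" unfolding \<epsilon>_def by real_asymp
  have "(\<lambda>k. P k y) \<longlonglongrightarrow> H y" for y
  proof -
    have "\<forall>\<^sub>F k in sequentially. \<bar>s k * y i\<bar> \<le> pi / 2" for i
    proof -
      have "(\<lambda>k. \<bar>s k * y i\<bar>) \<longlonglongrightarrow> \<bar>0 * y i\<bar>" by (intro tendsto_intros s0)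
      then have "\<forall>\<^sub>F k in sequentially. \<bar>s k * y i\<bar> < pi / 2"
        by (rule order_tendstoD) simp
      then show ?thesis by (rule eventually_mono) simp
    qed
    then have "\<forall>\<^sub>F k in sequentially. \<forall>i\<in>{..<N}. \<bar>s k * y i\<bar> \<le> pi / 2"
      by (intro eventually_ball_finite) auto
    then have "\<forall>\<^sub>F k in sequentially. norm (P k y - H y) \<le> \<epsilon> k"
      by (rule eventually_mono) (use P(3) in auto)
    then have "(\<lambda>k. P k y - H y) \<longlonglongrightarrow> 0"
      by (rule Lim_null_comparison[OF _ \<epsilon>0])
    then show ?thesis by (simp add: LIM_zero_iff)
  qed
  moreover have "\<bar>P k y\<bar> \<le> B + 1" for k y
    using P(2)[of k y] \<epsilon>(2)[of k] by linarith
  moreover have "\<bar>H y\<bar> \<le> B + 1" for y using B[of y] by linarith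
  ultimately show thesis using that[of P "B + 1"] P(1) by blast
qed

section \<open>Gaussian integration by parts\<close>

lemma tendsto_fun_iff:
  fixes f :: "'x \<Rightarrow> 'i \<Rightarrow> 'b::topological_space"
  shows "(f \<longlongrightarrow> l) F \<longleftrightarrow> (\<forall>i. ((\<lambda>x. f x i) \<longlongrightarrow> l i) F)"
  using limitin_componentwise[of "\<lambda>_. euclidean" UNIV f l F]
  by (simp add: euclidean_product_topology)

text \<open>The increment may have either sign or vanish, as it will be built from covariances and
  pairings.\<close>

lemma real_mean_value:
  fixes g :: "real \<Rightarrow> real"
  assumes g: "\<And>s. (g has_real_derivative g' s) (at s)"
  shows "\<exists>s. \<bar>s - a\<bar> \<le> \<bar>h\<bar> \<and> g (a + h) - g a = h * g' s"
proof (cases h "0 :: real" rule: linorder_cases)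
  case less
  then obtain s where "a + h < s" "s < a" "g a - g (a + h) = (a - (a + h)) * g' s"
    using MVT2[of "a + h" a g g'] g by auto
  then show ?thesis by (intro exI[of _ s]) auto
next
  case greater
  then obtain s where "a < s" "s < a + h" "g (a + h) - g a = (a + h - a) * g' s"
    using MVT2[of a "a + h" g g'] g by auto
  then show ?thesis by (intro exI[of _ s]) auto
qed (auto intro!: exI[of _ a])

text \<open>The coordinates are moved one at a time, with the one-dimensional mean value theorem at
  each move. The intermediate points differ from term to term but all stay in the box around
  \<open>y\<close> given by \<open>d\<close>.\<close>

lemma directional_increment:
  fixes H :: "(nat \<Rightarrow> real) \<Rightarrow> real"
  assumes deriv: "\<And>i y. i < N \<Longrightarrow> ((\<lambda>t. H (y(i := t))) has_real_derivative DH i y) (at (y i))"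
  shows "\<exists>\<xi>. (\<forall>i j. \<bar>\<xi> i j - y j\<bar> \<le> \<bar>d j\<bar>) \<and>
     H (\<lambda>j. if j < N then y j + d j else y j) - H y = (\<Sum>i<N. d i * DH i (\<xi> i))"
  using deriv
proof (induction N)
  case 0
  then show ?case by (intro exI[of _ "\<lambda>_. y"]) simp
next
  case (Suc n)
  then obtain \<xi> where \<xi>: "\<And>i j. \<bar>\<xi> i j - y j\<bar> \<le> \<bar>d j\<bar>"
    "H (\<lambda>j. if j < n then y j + d j else y j) - H y = (\<Sum>i<n. d i * DH i (\<xi> i))"
    by auto
  \<comment> \<open>The point after the first \<open>n\<close> moves; its coordinate
    \<open>n\<close> is still \<open>y n\<close>.\<close>
  define z where "z = (\<lambda>j. if j < n then y j + d j else y j)"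
  have "((\<lambda>t. H (z(n := t))) has_real_derivative DH n (z(n := s))) (at s)" for s
    using Suc.prems[of n "z(n := s)"] by (simp del: fun_upd_apply add: fun_upd_same)
  from real_mean_value[of "\<lambda>t. H (z(n := t))", OF this, of "y n" "d n"]
  obtain s where s: "\<bar>s - y n\<bar> \<le> \<bar>d n\<bar>"
    "H (z(n := y n + d n)) - H (z(n := y n)) = d n * DH n (z(n := s))" by auto
  have eq: "z(n := y n) = z" "z(n := y n + d n) = (\<lambda>j. if j < Suc n then y j + d j else y j)"
    by (auto simp: z_def)
  have "\<bar>(z(n := s)) j - y j\<bar> \<le> \<bar>d j\<bar>" for j
    using s by (simp add: z_def)
  then show ?case
    using \<xi> s eq by (intro exI[of _ "\<xi>(n := z(n := s))"]) (auto simp: z_def)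
qed

text \<open>\<open>C i\<close> is the covariance of \<open>X\<close> and \<open>Y i\<close>.  The assumptions are what the characteristic function
  of a centred Gaussian vector and its derivative in the direction of \<open>X\<close> say.\<close>

locale gaussian_pairing = prob_space M for M :: "'a measure" +
  fixes N :: nat and Y :: "nat \<Rightarrow> 'a \<Rightarrow> real" and X :: "'a \<Rightarrow> real" and C :: "nat \<Rightarrow> real"
  assumes Y_meas [measurable]: "\<And>i. Y i \<in> borel_measurable M"
    and X_int: "integrable M X"
    and X_cos: "\<And>w. expectation (\<lambda>u. X u * cos (\<Sum>i<N. w i * Y i u)) = 0"
    and X_sin: "\<And>w. expectation (\<lambda>u. X u * sin (\<Sum>i<N. w i * Y i u)) =
                  (\<Sum>i<N. w i * C i) * expectation (\<lambda>u. cos (\<Sum>i<N. w i * Y i u))"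
    and sin_0: "\<And>w. expectation (\<lambda>u. sin (\<Sum>i<N. w i * Y i u)) = 0"
begin

lemma X_meas [measurable]: "X \<in> borel_measurable M"
  using X_int by (rule borel_measurable_integrable)

text \<open>The covariance vector \<open>C\<close> is the Cameron-Martin direction belonging to
  \<open>X\<close>; expectations are differentiated along it.\<close>

definition shifted :: "real \<Rightarrow> 'a \<Rightarrow> nat \<Rightarrow> real" where
  "shifted t u i = Y i u + t * C i"

lemma shifted_meas [measurable]: "shifted t \<in> borel_measurable M"
  by (rule measurable_coordinatewise_then_product) (simp add: shifted_def[abs_def])

lemma comp_shifted_meas:
  assumes "continuous_on UNIV H"
  shows "(\<lambda>u. H (shifted t u)) \<in> borel_measurable M"
  using borel_measurable_continuous_onI[OF assms] by measurable

lemma integrable_comp_shifted: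
  assumes "continuous_on UNIV H" "\<And>y. \<bar>H y\<bar> \<le> B"
  shows "integrable M (\<lambda>u. H (shifted t u))" "integrable M (\<lambda>u. X u * H (shifted t u))"
proof -
  note [measurable] = comp_shifted_meas[OF assms(1)]
  show "integrable M (\<lambda>u. H (shifted t u))"
    by (rule integrable_const_bound[of _ B]) (use assms in auto)
  show "integrable M (\<lambda>u. X u * H (shifted t u))"
  proof (rule Bochner_Integration.integrable_bound)
    show "integrable M (\<lambda>u. B * X u)" using X_int by simp
    have "\<bar>X u\<bar> * \<bar>H (shifted t u)\<bar> \<le> \<bar>X u\<bar> * \<bar>B\<bar>" for u
      using assms(2)[of "shifted t u"] by (intro mult_left_mono) auto
    then show "AE u in M. norm (X u * H (shifted t u)) \<le> norm (B * X u)"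
      by (auto simp: abs_mult mult.commute)
  qed measurable
qed

text \<open>For a single cosine the angle addition formula separates \<open>t\<close> from the
  random phase. By \<open>sin_0\<close>, \<open>X_cos\<close> and \<open>X_sin\<close> both sides
  reduce to multiples of \<open>E\<close>, the expectation of \<open>cos (S u)\<close>.\<close>

lemma trig_flow_derivative:
  assumes "P \<in> trig_poly N"
  shows "((\<lambda>t. expectation (\<lambda>u. P (shifted t u))) has_real_derivative
            expectation (\<lambda>u. X u * P (shifted t u))) (at t)"
  using assms
proof (induction rule: trig_poly.induct)
  case (base a w b)
  define S where "S u = (\<Sum>i<N. w i * Y i u)" for u
  define \<kappa> where "\<kappa> = (\<Sum>i<N. w i * C i)"
  define E where "E = expectation (\<lambda>u. cos (S u))"
  have [measurable]: "S \<in> borel_measurable M" unfolding S_def[abs_def] by measurable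
  have eq: "a * cos ((\<Sum>i<N. w i * shifted t u i) + b) =
      a * cos (t * \<kappa> + b) * cos (S u) - a * sin (t * \<kappa> + b) * sin (S u)" for t u
  proof -
    have "(\<Sum>i<N. w i * shifted t u i) + b = S u + (t * \<kappa> + b)"
      by (simp add: shifted_def S_def \<kappa>_def sum.distrib sum_distrib_left algebra_simps)
    then show ?thesis
      using cos_add[of "S u" "t * \<kappa> + b"] by (simp only: right_diff_distrib mult_ac)
  qed
  have int: "integrable M (\<lambda>u. cos (S u))" "integrable M (\<lambda>u. sin (S u))"
    by (auto intro!: integrable_const_bound[of _ 1])
  have intX: "integrable M (\<lambda>u. X u * cos (S u))" "integrable M (\<lambda>u. X u * sin (S u))"
    by (rule Bochner_Integration.integrable_bound[OF X_int]; auto simp: abs_mult intro!: mult_left_le)+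
  have b: "expectation (\<lambda>u. a * cos ((\<Sum>i<N. w i * shifted t u i) + b)) = a * cos (t * \<kappa> + b) * E" for t
    unfolding eq using int sin_0[of w] by (simp add: E_def S_def)
  have "expectation (\<lambda>u. X u * (a * cos ((\<Sum>i<N. w i * shifted t u i) + b))) =
     expectation (\<lambda>u. a * cos (t * \<kappa> + b) * (X u * cos (S u)) - a * sin (t * \<kappa> + b) * (X u * sin (S u)))"
    unfolding eq by (simp add: algebra_simps)
  also have "\<dots> = - a * sin (t * \<kappa> + b) * \<kappa> * E"
    using intX X_cos[of w] X_sin[of w] by (simp add: E_def S_def \<kappa>_def)
  finally show ?case
    unfolding b by (auto intro!: derivative_eq_intros)
next
  case (add f g)
  obtain B B' where "\<And>y. \<bar>f y\<bar> \<le> B" "\<And>y. \<bar>g y\<bar> \<le> B'"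
    using trig_poly_bounded[OF add(1)] trig_poly_bounded[OF add(2)] by blast
  note int = integrable_comp_shifted[OF continuous_on_trig_poly[OF add(1)] this(1)]
    integrable_comp_shifted[OF continuous_on_trig_poly[OF add(2)] this(2)]
  show ?case
    using int DERIV_add[OF add.IH] by (simp add: distrib_left)
qed

text \<open>For trigonometric polynomials this is the fundamental theorem of calculus. No derivative
  of \<open>H\<close> occurs, so bounded pointwise approximation carries the identity over to
  \<open>H\<close>.\<close>

lemma flow_integral:
  assumes H: "box_supported N R H"
  assumes True: "0 \<le> T"
  shows "((\<lambda>t. expectation (\<lambda>u. X u * H (shifted t u))) has_integral
           expectation (\<lambda>u. H (shifted T u)) - expectation (\<lambda>u. H (shifted 0 u))) {0..T}"
proof -
  obtain P B where P: "\<And>k. P k \<in> trig_poly N" "\<And>k y. \<bar>P k y\<bar> \<le> B" "\<And>y. \<bar>H y\<bar> \<le> B"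
    "\<And>y. (\<lambda>k::nat. P k y) \<longlonglongrightarrow> H y"
    using trig_poly_approx[OF H] by blast
  note H_meas [measurable] = comp_shifted_meas[OF box_supportedD(1)[OF H]]
  note P_meas [measurable] = comp_shifted_meas[OF continuous_on_trig_poly[OF P(1)]]
  \<comment> \<open>One majorant for all \<open>k\<close> and \<open>t\<close>: it dominates the
    integrands in \<open>u\<close>, and its expectation dominates the integrands in
    \<open>t\<close>.\<close>
  have bound: "\<bar>X u * P k (shifted t u)\<bar> \<le> B * \<bar>X u\<bar>" for u k t
    unfolding abs_mult using mult_right_mono[OF P(2)[of k "shifted t u"], of "\<bar>X u\<bar>"] by (simp add: mult.commute)
  show ?thesis
  proof (rule has_integral_dominated_convergence)
    show "((\<lambda>t. expectation (\<lambda>u. X u * P k (shifted t u))) has_integral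
           expectation (\<lambda>u. P k (shifted T u)) - expectation (\<lambda>u. P k (shifted 0 u))) {0..T}" for k
      using True trig_flow_derivative[OF P(1)]
      by (intro fundamental_theorem_of_calculus)
        (auto simp: has_real_derivative_iff_has_vector_derivative[symmetric] intro: DERIV_subset)
    show "(\<lambda>t. B * expectation (\<lambda>u. \<bar>X u\<bar>)) integrable_on {0..T}" by (rule integrable_const_ivl)
    show "\<forall>t\<in>{0..T}. norm (expectation (\<lambda>u. X u * P k (shifted t u))) \<le> B * expectation (\<lambda>u. \<bar>X u\<bar>)" for k
    proof
      fix t
      have "integrable M (\<lambda>u. X u * P k (shifted t u))"
        by (rule integrable_comp_shifted(2)[OF continuous_on_trig_poly[OF P(1)] P(2)])
      then have "norm (expectation (\<lambda>u. X u * P k (shifted t u))) \<le> expectation (\<lambda>u. B * \<bar>X u\<bar>)"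
        using bound[of _ k t] X_int by (intro order_trans[OF integral_norm_bound integral_mono]) auto
      then show "norm (expectation (\<lambda>u. X u * P k (shifted t u))) \<le> B * expectation (\<lambda>u. \<bar>X u\<bar>)"
        by simp
    qed
    show "\<forall>t\<in>{0..T}. (\<lambda>k. expectation (\<lambda>u. X u * P k (shifted t u))) \<longlonglongrightarrow> expectation (\<lambda>u. X u * H (shifted t u))"
    proof
      fix t
      show "(\<lambda>k. expectation (\<lambda>u. X u * P k (shifted t u))) \<longlonglongrightarrow> expectation (\<lambda>u. X u * H (shifted t u))"
        by (rule integral_dominated_convergence[of _ _ _ "\<lambda>u. B * \<bar>X u\<bar>"])
          (use bound X_int P(4) in \<open>auto intro!: tendsto_intros\<close>)
    qed
    have "(\<lambda>k. expectation (\<lambda>u. P k (shifted t u))) \<longlonglongrightarrow> expectation (\<lambda>u. H (shifted t u))" for t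
      by (rule integral_dominated_convergence[of _ _ _ "\<lambda>u. B"]) (use P in auto)
    then show "(\<lambda>k. expectation (\<lambda>u. P k (shifted T u)) - expectation (\<lambda>u. P k (shifted 0 u)))
        \<longlonglongrightarrow> expectation (\<lambda>u. H (shifted T u)) - expectation (\<lambda>u. H (shifted 0 u))"
      by (intro tendsto_diff)
  qed
qed

text \<open>The identity of \<open>flow_integral\<close> is divided by a time tending to 0. The time
  average of the continuous function \<open>a\<close> tends to \<open>a 0\<close>, and the
  difference quotients of \<open>H\<close> converge by the mean value theorem and dominated
  convergence.\<close>

lemma integration_by_parts:
  assumes H: "box_supported N R H"
    and DH: "\<And>i. i < N \<Longrightarrow> box_supported N R (DH i)"
    and deriv: "\<And>i y. i < N \<Longrightarrow> ((\<lambda>t. H (y(i := t))) has_real_derivative DH i y) (at (y i))"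
  shows "expectation (\<lambda>u. X u * H (\<lambda>i. Y i u)) = (\<Sum>i<N. C i * expectation (\<lambda>u. DH i (\<lambda>i. Y i u)))"
proof -
  define a where "a t = expectation (\<lambda>u. X u * H (shifted t u))" for t
  define b where "b t = expectation (\<lambda>u. H (shifted t u))" for t
  define T where "T k = 1 / real (Suc k)" for k
  have T0: "T \<longlonglongrightarrow> 0" unfolding T_def by (rule LIMSEQ_Suc[OF lim_1_over_n])
  have T_pos: "T k > 0" "T k \<le> 1" for k by (auto simp: T_def)
  have Y_eq: "(\<lambda>i. Y i u) = shifted 0 u" for u by (simp add: shifted_def[abs_def])
  obtain B where B: "\<And>y. \<bar>H y\<bar> \<le> B" using box_supported_bounded[OF H] by blast
  note contH = box_supportedD(1)[OF H]
  have shifted_tendsto: "(\<lambda>k. shifted (t k) u) \<longlonglongrightarrow> shifted t' u" if "t \<longlonglongrightarrow> t'" for t t' u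
    unfolding tendsto_fun_iff shifted_def using that by (auto intro!: tendsto_intros)
  have "continuous_on {0..1} a"
  proof (rule continuous_on_sequentiallyI)
    fix t :: "nat \<Rightarrow> real" and t' assume t: "t \<longlonglongrightarrow> t'"
    show "(\<lambda>n. a (t n)) \<longlonglongrightarrow> a t'"
      unfolding a_def
    proof (rule integral_dominated_convergence[of _ _ _ "\<lambda>u. B * \<bar>X u\<bar>"])
      show "AE u in M. (\<lambda>n. X u * H (shifted (t n) u)) \<longlonglongrightarrow> X u * H (shifted t' u)"
        using shifted_tendsto[OF t] contH
        by (intro AE_I2 tendsto_mult tendsto_const continuous_on_tendsto_compose[OF contH]) auto
      show "AE u in M. norm (X u * H (shifted (t n) u)) \<le> B * \<bar>X u\<bar>" for n
        using mult_left_mono[OF B abs_ge_zero] by (intro AE_I2) (simp add: abs_mult mult.commute[of B])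
      show "integrable M (\<lambda>u. B * \<bar>X u\<bar>)" using X_int by simp
    qed (use integrable_comp_shifted(2)[OF contH B] in auto)
  qed
  \<comment> \<open>A one-sided derivative at 0 suffices, matching the nonnegative times of
    \<open>flow_integral\<close>.\<close>
  then have "((\<lambda>t. integral {0..t} a) has_real_derivative a 0) (at 0 within {0..1})"
    by (rule integral_has_real_derivative) simp
  then have "(\<lambda>k. (integral {0..T k} a - integral {0..0} a) / (T k - 0)) \<longlonglongrightarrow> a 0"
    unfolding has_field_derivative_iff tendsto_at_iff_sequentially o_def
    by (elim allE[of _ T] impE) (use T0 T_pos in \<open>auto simp: less_le\<close>)
  moreover have "integral {0..T k} a = b (T k) - b 0" for k
    unfolding a_def b_def using T_pos by (intro integral_unique flow_integral[OF H]) (simp add: less_imp_le)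
  ultimately have "(\<lambda>k. (b (T k) - b 0) / T k) \<longlonglongrightarrow> a 0" by simp
  then have lim1: "(\<lambda>k. expectation (\<lambda>u. (H (shifted (T k) u) - H (shifted 0 u)) / T k)) \<longlonglongrightarrow> a 0"
    using integrable_comp_shifted(1)[OF contH B] by (simp add: b_def)
  have "\<forall>i. \<exists>B. i < N \<longrightarrow> (\<forall>y. \<bar>DH i y\<bar> \<le> B)"
    using box_supported_bounded[OF DH] by blast
  then obtain BD where BD: "\<And>i y. i < N \<Longrightarrow> \<bar>DH i y\<bar> \<le> BD i" by metis
  \<comment> \<open>The intermediate points are chosen separately for each \<open>u\<close>. They
    give the bound and the pointwise limit; measurability is checked on the difference quotient
    itself.\<close>
  define Q where "Q k u \<xi> \<longleftrightarrow> (\<forall>i j. \<bar>\<xi> i j - shifted 0 u j\<bar> \<le> \<bar>T k * C j\<bar>) \<and>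
     (H (shifted (T k) u) - H (shifted 0 u)) / T k = (\<Sum>i<N. C i * DH i (\<xi> i))" for k u \<xi>
  have "\<exists>\<xi>. Q k u \<xi>" for k u
  proof -
    have "\<exists>\<xi>. (\<forall>i j. \<bar>\<xi> i j - shifted 0 u j\<bar> \<le> \<bar>T k * C j\<bar>) \<and>
      H (\<lambda>j. if j < N then shifted 0 u j + T k * C j else shifted 0 u j) - H (shifted 0 u)
        = (\<Sum>i<N. T k * C i * DH i (\<xi> i))"
      by (rule directional_increment) (rule deriv)
    then obtain \<xi> where \<xi>: "\<And>i j. \<bar>\<xi> i j - shifted 0 u j\<bar> \<le> \<bar>T k * C j\<bar>"
      "H (\<lambda>j. if j < N then shifted 0 u j + T k * C j else shifted 0 u j) - H (shifted 0 u)
        = (\<Sum>i<N. T k * C i * DH i (\<xi> i))"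
      by (elim exE conjE) blast
    \<comment> \<open>\<open>directional_increment\<close> moves the first \<open>N\<close>
      coordinates and \<open>shifted\<close> moves all of them, but \<open>H\<close> cannot tell the
      difference.\<close>
    have "H (\<lambda>j. if j < N then shifted 0 u j + T k * C j else shifted 0 u j) = H (shifted (T k) u)"
      by (rule box_supportedD(2)[OF H]) (simp add: shifted_def)
    with \<xi>(2) have "H (shifted (T k) u) - H (shifted 0 u) = T k * (\<Sum>i<N. C i * DH i (\<xi> i))"
      by (simp add: sum_distrib_left mult.assoc)
    then show ?thesis using \<xi>(1) T_pos(1)[of k] by (auto simp: Q_def)
  qed
  then obtain \<xi> where Q: "\<And>k u. Q k u (\<xi> k u)" by metis
  have \<xi>: "\<And>k u i j. \<bar>\<xi> k u i j - shifted 0 u j\<bar> \<le> \<bar>T k * C j\<bar>"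
     "\<And>k u. (H (shifted (T k) u) - H (shifted 0 u)) / T k = (\<Sum>i<N. C i * DH i (\<xi> k u i))"
    using Q unfolding Q_def by blast+
  have \<xi>_lim: "(\<lambda>k. \<xi> k u i) \<longlonglongrightarrow> shifted 0 u" for u i
    unfolding tendsto_fun_iff
  proof
    fix j
    have "(\<lambda>k. \<bar>T k * C j\<bar>) \<longlonglongrightarrow> \<bar>0 * C j\<bar>" by (intro tendsto_intros T0)
    then have lim: "(\<lambda>k. \<bar>T k * C j\<bar>) \<longlonglongrightarrow> 0" by simp
    have "\<forall>\<^sub>F k in sequentially. norm (\<xi> k u i j - shifted 0 u j) \<le> \<bar>T k * C j\<bar>"
      unfolding real_norm_def by (rule always_eventually) (rule allI, rule \<xi>(1))
    then have "(\<lambda>k. \<xi> k u i j - shifted 0 u j) \<longlonglongrightarrow> 0"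
      by (rule Lim_null_comparison) (rule lim)
    then show "(\<lambda>k. \<xi> k u i j) \<longlonglongrightarrow> shifted 0 u j" by (simp add: LIM_zero_iff)
  qed
  have DH_int: "integrable M (\<lambda>u. DH i (shifted 0 u))" if "i < N" for i
    using integrable_comp_shifted(1)[OF box_supportedD(1)[OF DH] BD] that by blast
  have "(\<lambda>k. expectation (\<lambda>u. (H (shifted (T k) u) - H (shifted 0 u)) / T k)) \<longlonglongrightarrow>
      expectation (\<lambda>u. \<Sum>i<N. C i * DH i (shifted 0 u))"
  proof (rule integral_dominated_convergence[of _ _ _ "\<lambda>u. \<Sum>i<N. \<bar>C i\<bar> * BD i"])
    show "AE u in M. (\<lambda>k. (H (shifted (T k) u) - H (shifted 0 u)) / T k) \<longlonglongrightarrow> (\<Sum>i<N. C i * DH i (shifted 0 u))"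
      unfolding \<xi>(2) using \<xi>_lim
      by (intro AE_I2 tendsto_sum tendsto_mult tendsto_const continuous_on_tendsto_compose[OF box_supportedD(1)[OF DH]]) auto
    show "AE u in M. norm ((H (shifted (T k) u) - H (shifted 0 u)) / T k) \<le> (\<Sum>i<N. \<bar>C i\<bar> * BD i)" for k
      unfolding \<xi>(2) by (intro AE_I2 sum_norm_le) (auto simp: abs_mult intro!: mult_left_mono BD)
    show "(\<lambda>u. \<Sum>i<N. C i * DH i (shifted 0 u)) \<in> borel_measurable M"
      using DH_int by (intro borel_measurable_sum borel_measurable_times borel_measurable_const) auto
    show "(\<lambda>u. (H (shifted (T k) u) - H (shifted 0 u)) / T k) \<in> borel_measurable M" for k
      using comp_shifted_meas[OF contH] by measurable
  qed simp
  then have "a 0 = expectation (\<lambda>u. \<Sum>i<N. C i * DH i (shifted 0 u))"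
    using lim1 LIMSEQ_unique by blast
  also have "\<dots> = (\<Sum>i<N. C i * expectation (\<lambda>u. DH i (shifted 0 u)))"
    using DH_int by simp
  finally show ?thesis by (simp add: a_def Y_eq)
qed

end

section \<open>Gaussian measures on a space of functionals\<close>

text \<open>Along a sequence, difference quotients become accessible to Fatou's lemma and dominated
  convergence.\<close>

lemma DERIV_lim_inverse_nat:
  fixes g :: "real \<Rightarrow> real"
  assumes "(g has_real_derivative D) (at 0)"
  shows "(\<lambda>k. (g (1 / real (Suc k)) - g 0) / (1 / real (Suc k))) \<longlonglongrightarrow> D"
proof -
  have lim: "(\<lambda>k. 1 / real (Suc k)) \<longlonglongrightarrow> 0" by (rule LIMSEQ_Suc[OF lim_1_over_n])
  have "(\<lambda>k. (g (1 / real (Suc k)) - g 0) / (1 / real (Suc k) - 0)) \<longlonglongrightarrow> D"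
    using assms unfolding has_field_derivative_iff tendsto_at_iff_sequentially o_def
    by (elim allE[of _ "\<lambda>k. 1 / real (Suc k)"] impE) (use lim in auto)
  then show ?thesis by simp
qed

text \<open>\<open>B\<close> is the covariance operator.\<close>

locale gaussian_functionals = prob_space M
  for M :: "('h::real_inner \<Rightarrow> real) measure" +
  fixes V :: "'h set" and B :: "'h \<Rightarrow> 'h"
  assumes V: "subspace V"
    and pairing_add: "\<And>u x y. u \<in> space M \<Longrightarrow> x \<in> V \<Longrightarrow> y \<in> V \<Longrightarrow> u (x + y) = u x + u y"
    and pairing_scale: "\<And>u x c. u \<in> space M \<Longrightarrow> x \<in> V \<Longrightarrow> u (c *\<^sub>R x) = c * u x"
    and pairing_meas: "\<And>v. v \<in> V \<Longrightarrow> (\<lambda>u. u v) \<in> borel_measurable M"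
    and B_linear: "bounded_linear B"
    and B_sym: "\<And>x y. inner (B x) y = inner x (B y)"
    and B_pos: "\<And>x. 0 \<le> inner x (B x)"
    and char_pairing: "\<And>v. v \<in> V \<Longrightarrow>
      (\<integral>u. exp (\<i> * complex_of_real (u v)) \<partial>M) = complex_of_real (exp (- (inner v (B v) / 2)))"
begin

lemma pairing_sum:
  assumes u: "u \<in> space M" and "\<And>i. i \<in> I \<Longrightarrow> x i \<in> V" "finite I"
  shows "u (\<Sum>i\<in>I. c i *\<^sub>R x i) = (\<Sum>i\<in>I. c i * u (x i))"
  using assms(3,2)
proof induction
  case empty
  then show ?case using pairing_scale[OF u subspace_0[OF V], of 0] by simp
next
  case (insert i I)
  have "(\<Sum>i\<in>I. c i *\<^sub>R x i) \<in> V"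
    using V insert.prems by (intro subspace_sum subspace_scale) auto
  then show ?case
    using insert V by (simp add: pairing_add[OF u] pairing_scale[OF u] subspace_scale)
qed

lemma expectation_cos_sin:
  assumes v: "v \<in> V"
  shows "expectation (\<lambda>u. cos (u v)) = exp (- (inner v (B v) / 2))" "expectation (\<lambda>u. sin (u v)) = 0"
proof -
  note [measurable] = pairing_meas[OF v]
  have int: "complex_integrable M (\<lambda>u. exp (\<i> * complex_of_real (u v)))"
    by (rule integrable_const_bound[of _ 1]) auto
  have "expectation (\<lambda>u. cos (u v)) = Re (\<integral>u. exp (\<i> * complex_of_real (u v)) \<partial>M)"
    by (subst integral_Re[OF int, symmetric]) (simp add: Re_exp)
  then show "expectation (\<lambda>u. cos (u v)) = exp (- (inner v (B v) / 2))"
    unfolding char_pairing[OF v] Re_complex_of_real .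
  have "expectation (\<lambda>u. sin (u v)) = Im (\<integral>u. exp (\<i> * complex_of_real (u v)) \<partial>M)"
    by (subst integral_Im[OF int, symmetric]) (simp add: Im_exp)
  then show "expectation (\<lambda>u. sin (u v)) = 0"
    unfolding char_pairing[OF v] Im_complex_of_real .
qed

text \<open>The functions \<open>2 * (1 - cos (s * u v)) / s^2\<close> have integrals known from the
  characteristic function and tend to \<open>(u v)^2\<close> as \<open>s\<close> tends to 0, so
  Fatou's lemma gives the bound.\<close>

lemma second_moment_le:
  assumes v: "v \<in> V"
  shows "(\<integral>\<^sup>+u. ennreal ((u v)\<^sup>2) \<partial>M) \<le> ennreal (inner v (B v))"
proof -
  note [measurable] = pairing_meas[OF v]
  define q where "q = inner v (B v)"
  define s where "s k = 1 / real (Suc k)" for k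
  have s: "s k > 0" for k by (simp add: s_def)
  \<comment> \<open>As a square the quotient is visibly nonnegative and its limit comes from a
    derivative at 0; \<open>f_eq\<close> restores the cosine form by the half-angle formula.\<close>
  define f where "f k u = (2 * sin (s k * u v / 2) / s k)\<^sup>2" for k u
  have lim: "(\<lambda>k. f k u) \<longlonglongrightarrow> (u v)\<^sup>2" for u
  proof -
    have "((\<lambda>t. 2 * sin (t * u v / 2)) has_real_derivative u v) (at 0)"
      by (auto intro!: derivative_eq_intros)
    from DERIV_lim_inverse_nat[OF this] show ?thesis
      unfolding f_def s_def by (intro tendsto_power) simp
  qed
  have f_eq: "f k u = 2 / (s k)\<^sup>2 * (1 - cos (s k * u v))" for k u
    using cos_double_sin[of "s k * u v / 2"] by (simp add: f_def power_divide power_mult_distrib)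
  have f_meas [measurable]: "f k \<in> borel_measurable M" for k
    unfolding f_def[abs_def] by measurable
  have int: "(\<integral>\<^sup>+u. ennreal (f k u) \<partial>M) \<le> ennreal q" for k
  proof -
    have cosint: "integrable M (\<lambda>u. cos (s k * u v))" by (rule integrable_const_bound[of _ 1]) auto
    have "expectation (\<lambda>u. cos (s k * u v)) = expectation (\<lambda>u. cos (u (s k *\<^sub>R v)))"
      using pairing_scale v by (intro Bochner_Integration.integral_cong) auto
    also have "\<dots> = exp (- ((s k)\<^sup>2 * q / 2))"
      using expectation_cos_sin(1)[of "s k *\<^sub>R v"] v V bounded_linear.linear[OF B_linear]
      by (simp add: subspace_scale linear_scale q_def power2_eq_square)
    finally have cosE: "expectation (\<lambda>u. cos (s k * u v)) = exp (- ((s k)\<^sup>2 * q / 2))" .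
    have "integrable M (f k)"
      unfolding f_eq[abs_def] using cosint by simp
    then have "(\<integral>\<^sup>+u. ennreal (f k u) \<partial>M) = ennreal (expectation (f k))"
      by (rule nn_integral_eq_integral) (simp add: f_def)
    also have "expectation (f k) = 2 / (s k)\<^sup>2 * (1 - exp (- ((s k)\<^sup>2 * q / 2)))"
      unfolding f_eq[abs_def] using cosint cosE prob_space by simp
    \<comment> \<open>This is \<open>1 - exp (- x) \<le> x\<close>, after which the factors
      \<open>s k\<close> cancel.\<close>
    also have "\<dots> \<le> 2 / (s k)\<^sup>2 * ((s k)\<^sup>2 * q / 2)"
      using exp_ge_add_one_self[of "- ((s k)\<^sup>2 * q / 2)"] by (intro mult_left_mono) auto
    also have "\<dots> = q" using s[of k] by simp
    finally show ?thesis by (simp add: ennreal_leI)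
  qed
  have "(\<integral>\<^sup>+u. ennreal ((u v)\<^sup>2) \<partial>M) = (\<integral>\<^sup>+u. liminf (\<lambda>k. ennreal (f k u)) \<partial>M)"
    using lim by (intro nn_integral_cong) (auto intro!: lim_imp_Liminf[symmetric])
  also have "\<dots> \<le> liminf (\<lambda>k. \<integral>\<^sup>+u. ennreal (f k u) \<partial>M)"
    by (rule nn_integral_liminf) measurable
  also have "\<dots> \<le> ennreal q"
    using int by (intro Liminf_le) auto
  finally show ?thesis by (simp add: q_def)
qed

lemma integrable_pairing:
  assumes v: "v \<in> V"
  shows "integrable M (\<lambda>u. (u v)\<^sup>2)" "integrable M (\<lambda>u. u v)"
proof -
  note [measurable] = pairing_meas[OF v]
  show "integrable M (\<lambda>u. (u v)\<^sup>2)"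
    using le_less_trans[OF second_moment_le[OF v] ennreal_less_top] by (intro integrableI_nonneg) auto
  then show "integrable M (\<lambda>u. u v)"
    by (rule square_integrable_imp_integrable[rotated]) measurable
qed

text \<open>Differentiation under the integral in the direction \<open>v\<close>: by the mean value
  theorem the difference quotients are dominated by \<open>\<bar>u v\<bar>\<close>, which is
  integrable. In the applications \<open>D\<close> is read off from the explicit characteristic
  function.\<close>

lemma expectation_pairing_deriv:
  assumes v: "v \<in> V" and w: "w \<in> V"
    and g: "\<And>x. (g has_real_derivative g' x) (at x)" "\<And>x. \<bar>g' x\<bar> \<le> 1" "\<And>x. \<bar>g x\<bar> \<le> 1"
      "continuous_on UNIV g'"
    and D: "((\<lambda>s. expectation (\<lambda>u. g (u (w + s *\<^sub>R v)))) has_real_derivative D) (at 0)"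
  shows "expectation (\<lambda>u. u v * g' (u w)) = D"
proof -
  note [measurable] = pairing_meas[OF v] pairing_meas[OF w]
  have [measurable]: "g \<in> borel_measurable borel" "g' \<in> borel_measurable borel"
    using g(1,4) by (auto intro!: borel_measurable_continuous_onI DERIV_continuous_on)
  define s where "s k = 1 / real (Suc k)" for k
  have s: "s k > 0" for k by (simp add: s_def)
  define q where "q k u = (g (u w + s k * u v) - g (u w)) / s k" for k u
  have gint: "integrable M (\<lambda>u. g (u w + t * u v))" for t
    using g(3) by (intro integrable_const_bound[of _ 1]) auto
  have "expectation (\<lambda>u. g (u (w + t *\<^sub>R v))) = expectation (\<lambda>u. g (u w + t * u v))" for t
    using v w V by (intro Bochner_Integration.integral_cong) (auto simp: pairing_add pairing_scale subspace_scale)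
  with DERIV_lim_inverse_nat[OF D]
  have "(\<lambda>k. (expectation (\<lambda>u. g (u w + s k * u v)) - expectation (\<lambda>u. g (u w))) / s k) \<longlonglongrightarrow> D"
    by (simp add: s_def)
  then have lim1: "(\<lambda>k. expectation (q k)) \<longlonglongrightarrow> D"
    using gint gint[of 0] by (simp add: q_def[abs_def])
  have "(\<lambda>k. expectation (q k)) \<longlonglongrightarrow> expectation (\<lambda>u. u v * g' (u w))"
  proof (rule integral_dominated_convergence[of _ _ _ "\<lambda>u. \<bar>u v\<bar>"])
    have "(\<lambda>k. q k u) \<longlonglongrightarrow> u v * g' (u w)" for u
    proof -
      have "((\<lambda>t. g (u w + t * u v)) has_real_derivative (g' (u w + 0 * u v) * u v)) (at 0)"
        by (rule DERIV_chain2[OF g(1)]) (auto intro!: derivative_eq_intros)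
      from DERIV_lim_inverse_nat[OF this] show ?thesis
        by (simp add: q_def s_def mult.commute)
    qed
    then show "AE u in M. (\<lambda>k. q k u) \<longlonglongrightarrow> u v * g' (u w)" by simp
    have "\<bar>q k u\<bar> \<le> \<bar>u v\<bar>" for k u
    proof -
      obtain x where "g (u w + s k * u v) - g (u w) = (s k * u v) * g' x"
        using real_mean_value[of g g' "u w" "s k * u v"] g(1) by blast
      then have "q k u = u v * g' x" using s[of k] by (simp add: q_def)
      then show ?thesis using g(2)[of x] by (simp add: abs_mult mult_left_le)
    qed
    then show "AE u in M. norm (q k u) \<le> \<bar>u v\<bar>" for k by simp
    show "integrable M (\<lambda>u. \<bar>u v\<bar>)" using integrable_pairing(2)[OF v] by simp
    show "q k \<in> borel_measurable M" for k unfolding q_def[abs_def] by measurable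
  qed measurable
  with lim1 show ?thesis using LIMSEQ_unique by blast
qed

text \<open>The real and imaginary parts of the characteristic function at \<open>w\<close> are
  differentiated in the direction \<open>v\<close>.\<close>

lemma expectation_pairing_cos_sin:
  assumes v: "v \<in> V" and w: "w \<in> V"
  shows "expectation (\<lambda>u. u v * cos (u w)) = 0"
    "expectation (\<lambda>u. u v * sin (u w)) = inner v (B w) * expectation (\<lambda>u. cos (u w))"
proof -
  have in_V: "w + s *\<^sub>R v \<in> V" for s
    using v w V by (simp add: subspace_add subspace_scale)
  show "expectation (\<lambda>u. u v * cos (u w)) = 0"
    by (rule expectation_pairing_deriv[of v w sin cos])
      (auto simp: v w expectation_cos_sin(2)[OF in_V] intro!: derivative_eq_intros continuous_intros)
  \<comment> \<open>Symmetry of \<open>B\<close> merges the two cross terms; the factor 1/2 in the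
    Gaussian exponent then leaves \<open>inner v (B w)\<close> in the derivative at 0.\<close>
  have "inner (w + s *\<^sub>R v) (B (w + s *\<^sub>R v)) = inner w (B w) + 2 * s * inner v (B w) + s\<^sup>2 * inner v (B v)" for s
    using B_sym[of w v] bounded_linear.linear[OF B_linear]
    by (simp add: linear_add linear_scale inner_add_left inner_add_right inner_commute[of "B _"] power2_eq_square algebra_simps)
  then have "((\<lambda>s. expectation (\<lambda>u. cos (u (w + s *\<^sub>R v)))) has_real_derivative
      - (inner v (B w) * exp (- (inner w (B w) / 2)))) (at 0)"
    unfolding expectation_cos_sin(1)[OF in_V] by (auto intro!: derivative_eq_intros)
  then have "expectation (\<lambda>u. u v * - sin (u w)) = - (inner v (B w) * exp (- (inner w (B w) / 2)))"
    by (intro expectation_pairing_deriv[of v w cos])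
      (auto simp: v w intro!: derivative_eq_intros continuous_intros)
  then show "expectation (\<lambda>u. u v * sin (u w)) = inner v (B w) * expectation (\<lambda>u. cos (u w))"
    by (simp add: expectation_cos_sin(1)[OF w])
qed

text \<open>A linear combination of coordinates is the pairing with one vector of \<open>V\<close>,
  so the formulas for single vectors supply the assumptions of
  \<open>gaussian_pairing\<close>.\<close>

lemma integration_by_parts_pairing:
  assumes v: "v \<in> V" and e: "\<And>i. e i \<in> V"
    and H: "box_supported N R H"
    and DH: "\<And>i. i < N \<Longrightarrow> box_supported N R (DH i)"
    and deriv: "\<And>i y. i < N \<Longrightarrow> ((\<lambda>t. H (y(i := t))) has_real_derivative DH i y) (at (y i))"
  shows "expectation (\<lambda>u. u v * H (\<lambda>i. u (e i))) =
    (\<Sum>i<N. inner v (B (e i)) * expectation (\<lambda>u. DH i (\<lambda>i. u (e i))))"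
proof -
  have eq: "(\<Sum>i<N. w i * u (e i)) = u (\<Sum>i<N. w i *\<^sub>R e i)" if "u \<in> space M" for u w
    by (subst pairing_sum) (auto simp: that e)
  have in_V: "(\<Sum>i<N. w i *\<^sub>R e i) \<in> V" for w
    using V e by (intro subspace_sum subspace_scale)
  have lin: "inner v (B (\<Sum>i<N. w i *\<^sub>R e i)) = (\<Sum>i<N. w i * inner v (B (e i)))" for w
    using bounded_linear.linear[OF B_linear] by (simp add: linear_sum linear_scale inner_sum_right)
  interpret gaussian_pairing M N "\<lambda>i u. u (e i)" "\<lambda>u. u v" "\<lambda>i. inner v (B (e i))"
  proof
    fix w
    have cong: "expectation (\<lambda>u. h (u v) (\<Sum>i<N. w i * u (e i))) =
        expectation (\<lambda>u. h (u v) (u (\<Sum>i<N. w i *\<^sub>R e i)))" for h :: "real \<Rightarrow> real \<Rightarrow> real"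
      by (intro Bochner_Integration.integral_cong) (auto simp: eq)
    show "expectation (\<lambda>u. u v * cos (\<Sum>i<N. w i * u (e i))) = 0"
      using cong[of "\<lambda>x y. x * cos y"] expectation_pairing_cos_sin(1)[OF v in_V] by simp
    show "expectation (\<lambda>u. u v * sin (\<Sum>i<N. w i * u (e i))) =
       (\<Sum>i<N. w i * inner v (B (e i))) * expectation (\<lambda>u. cos (\<Sum>i<N. w i * u (e i)))"
      using cong[of "\<lambda>x y. x * sin y"] cong[of "\<lambda>x y. cos y"] expectation_pairing_cos_sin(2)[OF v in_V]
      by (simp add: lin)
    show "expectation (\<lambda>u. sin (\<Sum>i<N. w i * u (e i))) = 0"
      using cong[of "\<lambda>x y. sin y"] expectation_cos_sin(2)[OF in_V] by simp
  qed (auto intro: pairing_meas e v integrable_pairing)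
  show ?thesis by (rule integration_by_parts[OF H DH deriv])
qed

end

section \<open>Extension of the pairing to the whole Hilbert space\<close>

context gaussian_functionals
begin

lemma pairing_diff:
  assumes "u \<in> space M" "x \<in> V" "y \<in> V"
  shows "u (x - y) = u x - u y"
  using pairing_add[OF assms(1,2), of "- y"] pairing_scale[OF assms(1,3), of "- 1"] subspace_neg[OF V assms(3)]
  by simp

text \<open>The covariance operator is bounded, so the second moment bound turns into a Lipschitz
  estimate. This is what extends the pairing from \<open>V\<close> to its closure.\<close>

lemma pairing_dist_le:
  obtains K where "0 \<le> K" "\<And>x y. x \<in> V \<Longrightarrow> y \<in> V \<Longrightarrow>
    (\<integral>\<^sup>+u. ennreal ((u x - u y)\<^sup>2) \<partial>M) \<le> ennreal (K * (norm (x - y))\<^sup>2)"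
proof -
  obtain K where K: "0 \<le> K" "\<And>x. norm (B x) \<le> norm x * K"
    using bounded_linear.nonneg_bounded[OF B_linear] by blast
  have "(\<integral>\<^sup>+u. ennreal ((u x - u y)\<^sup>2) \<partial>M) \<le> ennreal (K * (norm (x - y))\<^sup>2)" if "x \<in> V" "y \<in> V" for x y
  proof -
    have "(\<integral>\<^sup>+u. ennreal ((u x - u y)\<^sup>2) \<partial>M) = (\<integral>\<^sup>+u. ennreal ((u (x - y))\<^sup>2) \<partial>M)"
      using that by (intro nn_integral_cong) (simp add: pairing_diff)
    also have "\<dots> \<le> ennreal (inner (x - y) (B (x - y)))"
      using that V by (intro second_moment_le) (simp add: subspace_diff)
    also have "inner (x - y) (B (x - y)) \<le> norm (x - y) * (norm (x - y) * K)"
      by (rule order_trans[OF norm_cauchy_schwarz mult_left_mono[OF K(2)]]) simp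
    finally show ?thesis
      by (simp add: ennreal_leI power2_eq_square mult_ac)
  qed
  with K(1) that show thesis by blast
qed

text \<open>A rapidly convergent approximating sequence has almost sure limits, which define
  \<open>g\<close>. Fatou's lemma then bounds the mean square distance from \<open>u y\<close> to
  \<open>g u\<close> in terms of \<open>norm (y - f)\<close>, so every other approximating sequence
  has the same limit.\<close>

lemma L2_pairing_exists:
  assumes dense: "closure V = UNIV"
  shows "\<exists>g. is_L2_pairing V M f g"
proof -
  obtain K where K: "0 \<le> K" "\<And>x y. x \<in> V \<Longrightarrow> y \<in> V \<Longrightarrow>
    (\<integral>\<^sup>+u. ennreal ((u x - u y)\<^sup>2) \<partial>M) \<le> ennreal (K * (norm (x - y))\<^sup>2)"
    using pairing_dist_le by blast
  have "\<exists>x\<in>V. dist x f < (1 / 2) ^ k" for k :: nat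
    using dense closure_approachable[of f V] by simp
  then obtain x where x: "\<And>k. x k \<in> V" "\<And>k. norm (x k - f) < (1 / 2) ^ k"
    unfolding dist_norm by metis
  have x_lim: "x \<longlonglongrightarrow> f"
  proof -
    have "(\<lambda>k. x k - f) \<longlonglongrightarrow> 0"
      by (rule Lim_null_comparison[of _ "\<lambda>k. (1 / 2) ^ k"])
        (use x(2) in \<open>auto intro!: always_eventually LIMSEQ_power_zero less_imp_le\<close>)
    then show ?thesis by (simp add: LIM_zero_iff)
  qed
  have meas [measurable]: "(\<lambda>u. u (x k)) \<in> borel_measurable M" for k
    by (rule pairing_meas[OF x(1)])
  define d where "d k u = u (x (Suc k)) - u (x k)" for k and u :: "'h \<Rightarrow> real"
  have [measurable]: "d k \<in> borel_measurable M" for k unfolding d_def[abs_def] by measurable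
  \<comment> \<open>The squared distances decay like \<open>4 ^ (- k)\<close>, so the weight
    \<open>2 ^ k\<close> still leaves a summable series.\<close>
  have step: "(\<integral>\<^sup>+u. ennreal (2 ^ k * (d k u)\<^sup>2) \<partial>M) \<le> ennreal (4 * K * (1 / 2) ^ k)" for k
  proof -
    have "norm (x (Suc k) - x k) \<le> norm (x (Suc k) - f) + norm (x k - f)"
      by (rule norm_triangle_le_diff[of "x (Suc k) - f" "x k - f", simplified]) simp
    also have "\<dots> \<le> (1 / 2) ^ Suc k + (1 / 2) ^ k"
      by (intro add_mono less_imp_le x(2))
    also have "\<dots> \<le> 2 * (1 / 2) ^ k" by simp
    finally have "(norm (x (Suc k) - x k))\<^sup>2 \<le> (2 * (1 / 2) ^ k)\<^sup>2"
      by (intro power_mono) auto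
    then have "2 ^ k * (K * (norm (x (Suc k) - x k))\<^sup>2) \<le> 2 ^ k * (K * (2 * (1 / 2) ^ k)\<^sup>2)"
      using K(1) by (intro mult_left_mono) auto
    also have "\<dots> = 4 * K * (1 / 2) ^ k"
      by (simp add: power_mult_distrib power2_eq_square power_divide)
    finally have le: "2 ^ k * (K * (norm (x (Suc k) - x k))\<^sup>2) \<le> 4 * K * (1 / 2) ^ k" .
    have "(\<integral>\<^sup>+u. ennreal (2 ^ k * (d k u)\<^sup>2) \<partial>M) = ennreal (2 ^ k) * (\<integral>\<^sup>+u. ennreal ((d k u)\<^sup>2) \<partial>M)"
      by (subst nn_integral_cmult[symmetric]) (auto simp: ennreal_mult)
    also have "\<dots> \<le> ennreal (2 ^ k) * ennreal (K * (norm (x (Suc k) - x k))\<^sup>2)"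
      unfolding d_def by (intro mult_left_mono K(2) x(1)) simp
    also have "\<dots> \<le> ennreal (4 * K * (1 / 2) ^ k)"
      using le K(1) by (subst ennreal_mult[symmetric]) (auto intro!: ennreal_leI)
    finally show ?thesis .
  qed
  have "(\<integral>\<^sup>+u. (\<Sum>k. ennreal (2 ^ k * (d k u)\<^sup>2)) \<partial>M) = (\<Sum>k. \<integral>\<^sup>+u. ennreal (2 ^ k * (d k u)\<^sup>2) \<partial>M)"
    by (rule nn_integral_suminf) measurable
  also have "\<dots> \<le> (\<Sum>k. ennreal (4 * K * (1 / 2) ^ k))"
    by (intro suminf_le step) auto
  also have "\<dots> < \<infinity>"
    using K(1) by (subst suminf_ennreal2) (auto intro!: summable_mult summable_geometric)
  finally have "AE u in M. (\<Sum>k. ennreal (2 ^ k * (d k u)\<^sup>2)) \<noteq> \<infinity>"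
    by (intro nn_integral_PInf_AE) auto
  then have conv: "AE u in M. convergent (\<lambda>k. u (x k))"
  proof eventually_elim
    case (elim u)
    then have s: "summable (\<lambda>k. 2 ^ k * (d k u)\<^sup>2)"
      by (intro summable_suminf_not_top) auto
    \<comment> \<open>Completing the square turns summability of the weighted squares into absolute
      summability of the increments.\<close>
    have "\<bar>d k u\<bar> \<le> (1 / 2) ^ k + 2 ^ k * (d k u)\<^sup>2" for k
    proof -
      have "0 \<le> (1 - 2 ^ k * \<bar>d k u\<bar>)\<^sup>2 / 2 ^ k" by simp
      also have "\<dots> = (1 / 2) ^ k - 2 * \<bar>d k u\<bar> + 2 ^ k * (d k u)\<^sup>2"
        by (simp add: power2_eq_square field_simps power_divide)
      finally show ?thesis by linarith
    qed
    then have le: "norm (d k u) \<le> (1 / 2) ^ k + 2 ^ k * (d k u)\<^sup>2" for k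
      by simp
    have "summable (\<lambda>k. (1 / 2) ^ k + 2 ^ k * (d k u)\<^sup>2)"
      by (rule summable_add[OF _ s]) (simp add: summable_geometric)
    then have "summable (\<lambda>k. d k u)"
      by (rule summable_comparison_test'[of _ 0]) (rule le)
    then have "convergent (\<lambda>n. u (x 0) + (\<Sum>k<n. d k u))"
      by (intro convergent_add convergent_const) (simp add: summable_iff_convergent)
    moreover have "u (x 0) + (\<Sum>k<n. d k u) = u (x n)" for n
      by (induction n) (simp_all add: d_def)
    ultimately show ?case by simp
  qed
  \<comment> \<open>Where the sequence diverges the value of \<open>lim\<close> is unspecified, but
    by \<open>conv\<close> this happens only on a null set.\<close>
  define g where "g u = lim (\<lambda>k. u (x k))" for u :: "'h \<Rightarrow> real"
  have g_meas [measurable]: "g \<in> borel_measurable M"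
    unfolding g_def by measurable
  have fatou: "(\<integral>\<^sup>+u. ennreal ((u y - g u)\<^sup>2) \<partial>M) \<le> ennreal (K * (norm (y - f))\<^sup>2)" if y: "y \<in> V" for y
  proof -
    note [measurable] = pairing_meas[OF y]
    have "(\<integral>\<^sup>+u. ennreal ((u y - g u)\<^sup>2) \<partial>M) = (\<integral>\<^sup>+u. liminf (\<lambda>k. ennreal ((u y - u (x k))\<^sup>2)) \<partial>M)"
    proof (rule nn_integral_cong_AE)
      show "AE u in M. ennreal ((u y - g u)\<^sup>2) = liminf (\<lambda>k. ennreal ((u y - u (x k))\<^sup>2))"
        using conv
      proof eventually_elim
        case (elim u)
        then have "(\<lambda>k. u (x k)) \<longlonglongrightarrow> g u" by (simp add: g_def convergent_LIMSEQ_iff)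
        then have "(\<lambda>k. ennreal ((u y - u (x k))\<^sup>2)) \<longlonglongrightarrow> ennreal ((u y - g u)\<^sup>2)"
          by (intro tendsto_ennrealI tendsto_intros)
        then show ?case by (intro lim_imp_Liminf[symmetric]) auto
      qed
    qed
    also have "\<dots> \<le> liminf (\<lambda>k. \<integral>\<^sup>+u. ennreal ((u y - u (x k))\<^sup>2) \<partial>M)"
      by (rule nn_integral_liminf) measurable
    also have "\<dots> \<le> liminf (\<lambda>k. ennreal (K * (norm (y - x k))\<^sup>2))"
      by (intro Liminf_mono always_eventually allI K(2) y x(1))
    also have "\<dots> = ennreal (K * (norm (y - f))\<^sup>2)"
      using x_lim by (intro lim_imp_Liminf tendsto_ennrealI tendsto_intros) auto
    finally show ?thesis .
  qed
  have "is_L2_pairing V M f g"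
    unfolding is_L2_pairing_def
  proof (intro conjI allI impI)
    have "integrable M (\<lambda>u. (u (x 0) - g u)\<^sup>2)"
      using le_less_trans[OF fatou[OF x(1)] ennreal_less_top] by (intro integrableI_nonneg) auto
    then have "integrable M (\<lambda>u. 2 * (u (x 0) - g u)\<^sup>2 + 2 * (u (x 0))\<^sup>2)"
      using integrable_pairing(1)[OF x(1)] by simp
    then show "integrable M (\<lambda>u. (g u)\<^sup>2)"
    proof (rule Bochner_Integration.integrable_bound)
      \<comment> \<open>The difference of the two sides is
        \<open>(2 * a - b)\<^sup>2\<close>.\<close>
      have "(b :: real)\<^sup>2 \<le> 2 * (a - b)\<^sup>2 + 2 * a\<^sup>2" for a b
        using sum_squares_ge_zero[of "2 * a - b" 0] by (simp add: power2_eq_square algebra_simps)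
      then show "AE u in M. norm ((g u)\<^sup>2) \<le> norm (2 * (u (x 0) - g u)\<^sup>2 + 2 * (u (x 0))\<^sup>2)"
        by simp
    qed measurable
  next
    fix y assume y: "range y \<subseteq> V \<and> y \<longlonglongrightarrow> f"
    have "(\<lambda>k. ennreal (K * (norm (y k - f))\<^sup>2)) \<longlonglongrightarrow> ennreal (K * (norm (f - f))\<^sup>2)"
      using y by (intro tendsto_ennrealI tendsto_intros) auto
    then have upper: "(\<lambda>k. ennreal (K * (norm (y k - f))\<^sup>2)) \<longlonglongrightarrow> 0" by simp
    have le: "\<forall>\<^sub>F k in sequentially.
        (\<integral>\<^sup>+u. ennreal ((u (y k) - g u)\<^sup>2) \<partial>M) \<le> ennreal (K * (norm (y k - f))\<^sup>2)"
      using y by (intro always_eventually allI fatou) auto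
    show "(\<lambda>k. \<integral>\<^sup>+u. ennreal ((u (y k) - g u)\<^sup>2) \<partial>M) \<longlonglongrightarrow> 0"
      by (rule tendsto_sandwich[OF _ le tendsto_const upper]) simp
  qed (rule g_meas)
  then show ?thesis by blast
qed

text \<open>This justifies the choice in \<open>L2_pairing\<close>; later arguments rest on the
  property and not on the chosen version.\<close>

lemma is_L2_pairing_L2_pairing: "closure V = UNIV \<Longrightarrow> is_L2_pairing V M f (L2_pairing V M f)"
  unfolding L2_pairing_def by (rule someI_ex[OF L2_pairing_exists])

lemma integrable_mult_box_supported:
  assumes z: "integrable M z" and e: "\<And>i. e i \<in> V" and H: "box_supported N R H"
  shows "integrable M (\<lambda>u. z u * H (\<lambda>i. u (e i)))"
proof -
  obtain b where b: "\<And>y. \<bar>H y\<bar> \<le> b" using box_supported_bounded[OF H] by blast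
  have [measurable]: "(\<lambda>u i. u (e i)) \<in> borel_measurable M"
    by (rule measurable_coordinatewise_then_product) (rule pairing_meas[OF e])
  have meas: "(\<lambda>u. H (\<lambda>i. u (e i))) \<in> borel_measurable M"
    using borel_measurable_continuous_onI[OF box_supportedD(1)[OF H]] by measurable
  show ?thesis
  proof (rule Bochner_Integration.integrable_bound)
    show "integrable M (\<lambda>u. b * z u)" using z by simp
    have "\<bar>H (\<lambda>i. u (e i))\<bar> * \<bar>z u\<bar> \<le> \<bar>b\<bar> * \<bar>z u\<bar>" for u
      using b[of "\<lambda>i. u (e i)"] by (intro mult_right_mono) auto
    then show "AE u in M. norm (z u * H (\<lambda>i. u (e i))) \<le> norm (b * z u)"
      by (simp add: abs_mult mult.commute)
  qed (use z meas in measurable)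
qed

text \<open>Both sides are continuous in \<open>f\<close>: the left one because \<open>H\<close> is
  bounded and the pairings converge in mean square, the right one because it is built from inner
  products with \<open>f\<close>. The case of vectors in \<open>V\<close> thus extends by
  density.\<close>

lemma integration_by_parts_L2_pairing:
  assumes dense: "closure V = UNIV" and g: "is_L2_pairing V M f g" and e: "\<And>i. e i \<in> V"
    and H: "box_supported N R H"
    and DH: "\<And>i. i < N \<Longrightarrow> box_supported N R (DH i)"
    and deriv: "\<And>i y. i < N \<Longrightarrow> ((\<lambda>t. H (y(i := t))) has_real_derivative DH i y) (at (y i))"
  shows "expectation (\<lambda>u. g u * H (\<lambda>i. u (e i))) =
    (\<Sum>i<N. inner f (B (e i)) * expectation (\<lambda>u. DH i (\<lambda>i. u (e i))))"
proof -
  obtain x where x: "\<And>k. x k \<in> V" "x \<longlonglongrightarrow> f"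
    using dense closure_sequential[of f V] by auto
  obtain b where b: "\<And>y. \<bar>H y\<bar> \<le> b" using box_supported_bounded[OF H] by blast
  define h where "h u = H (\<lambda>i. u (e i))" for u :: "'h \<Rightarrow> real"
  have [measurable]: "g \<in> borel_measurable M" and g2: "integrable M (\<lambda>u. (g u)\<^sup>2)"
    using g by (auto simp: is_L2_pairing_def)
  have g_int: "integrable M g" using g2 by (rule square_integrable_imp_integrable[rotated]) measurable
  have [measurable]: "(\<lambda>u. u (x k)) \<in> borel_measurable M" for k
    by (rule pairing_meas[OF x(1)])
  have bounded_mult: "integrable M (\<lambda>u. z u * h u)" if "integrable M z" for z
    unfolding h_def by (rule integrable_mult_box_supported[OF that e H])
  define Z where "Z k u = u (x k) - g u" for k u
  have Z_int: "integrable M (Z k)" for k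
    unfolding Z_def using integrable_pairing(2)[OF x(1)] g_int by simp
  have Z2_int: "integrable M (\<lambda>u. (Z k u)\<^sup>2)" for k
  proof (rule Bochner_Integration.integrable_bound)
    show "integrable M (\<lambda>u. 2 * (u (x k))\<^sup>2 + 2 * (g u)\<^sup>2)"
      using integrable_pairing(1)[OF x(1)] g2 by simp
    have "(p - q :: real)\<^sup>2 \<le> 2 * p\<^sup>2 + 2 * q\<^sup>2" for p q
      using sum_squares_ge_zero[of "p + q" 0] by (simp add: power2_eq_square algebra_simps)
    then show "AE u in M. norm ((Z k u)\<^sup>2) \<le> norm (2 * (u (x k))\<^sup>2 + 2 * (g u)\<^sup>2)"
      by (simp add: Z_def)
  qed (simp add: Z_def[abs_def])
  have "(\<lambda>k. \<integral>\<^sup>+u. ennreal ((Z k u)\<^sup>2) \<partial>M) \<longlonglongrightarrow> 0"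
    using g x unfolding is_L2_pairing_def Z_def by blast
  then have "(\<lambda>k. ennreal (expectation (\<lambda>u. (Z k u)\<^sup>2))) \<longlonglongrightarrow> ennreal 0"
    using nn_integral_eq_integral[OF Z2_int] by simp
  then have Z2_lim: "(\<lambda>k. sqrt (expectation (\<lambda>u. (Z k u)\<^sup>2))) \<longlonglongrightarrow> 0"
    by (intro tendsto_real_sqrt[of _ 0, simplified] tendsto_ennrealD) (auto intro!: always_eventually)
  \<comment> \<open>Nonnegativity of the variance compares the L1 norm with the L2 norm.\<close>
  have Z_abs: "expectation (\<lambda>u. \<bar>Z k u\<bar>) \<le> sqrt (expectation (\<lambda>u. (Z k u)\<^sup>2))" for k
  proof -
    have "variance (\<lambda>u. \<bar>Z k u\<bar>) = expectation (\<lambda>u. \<bar>Z k u\<bar>\<^sup>2) - (expectation (\<lambda>u. \<bar>Z k u\<bar>))\<^sup>2"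
      using Z_int Z2_int by (intro variance_eq) auto
    then have "(expectation (\<lambda>u. \<bar>Z k u\<bar>))\<^sup>2 \<le> expectation (\<lambda>u. (Z k u)\<^sup>2)"
      using variance_positive[of "\<lambda>u. \<bar>Z k u\<bar>"] by simp
    then show ?thesis by (rule real_le_rsqrt)
  qed
  have "(\<lambda>k. expectation (\<lambda>u. Z k u * h u)) \<longlonglongrightarrow> 0"
  proof (rule Lim_null_comparison)
    have "norm (expectation (\<lambda>u. Z k u * h u)) \<le> b * sqrt (expectation (\<lambda>u. (Z k u)\<^sup>2))" for k
    proof -
      have "norm (expectation (\<lambda>u. Z k u * h u)) \<le> expectation (\<lambda>u. norm (Z k u * h u))"
        by (rule integral_norm_bound)
      also have "\<dots> \<le> expectation (\<lambda>u. b * \<bar>Z k u\<bar>)"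
      proof (rule integral_mono)
        show "integrable M (\<lambda>u. norm (Z k u * h u))"
          using bounded_mult[OF Z_int] by simp
        show "norm (Z k u * h u) \<le> b * \<bar>Z k u\<bar>" for u
          using mult_right_mono[OF b[of "\<lambda>i. u (e i)"], of "\<bar>Z k u\<bar>"] by (simp add: h_def abs_mult mult.commute)
      qed (use Z_int in auto)
      also have "\<dots> \<le> b * sqrt (expectation (\<lambda>u. (Z k u)\<^sup>2))"
        using Z_abs[of k] order_trans[OF abs_ge_zero b] by (simp add: mult_left_mono)
      finally show ?thesis .
    qed
    then show "\<forall>\<^sub>F k in sequentially. norm (expectation (\<lambda>u. Z k u * h u)) \<le> b * sqrt (expectation (\<lambda>u. (Z k u)\<^sup>2))"
      by simp
    show "(\<lambda>k. b * sqrt (expectation (\<lambda>u. (Z k u)\<^sup>2))) \<longlonglongrightarrow> 0"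
      using tendsto_mult_right_zero[OF Z2_lim] .
  qed
  moreover have "expectation (\<lambda>u. Z k u * h u) =
      (\<Sum>i<N. inner (x k) (B (e i)) * expectation (\<lambda>u. DH i (\<lambda>i. u (e i)))) - expectation (\<lambda>u. g u * h u)" for k
    using integration_by_parts_pairing[of "x k" e N R H DH, OF x(1) e H DH deriv, unfolded h_def[symmetric]]
      bounded_mult[OF integrable_pairing(2)[OF x(1)]] bounded_mult[OF g_int]
    by (simp add: Z_def left_diff_distrib)
  ultimately have "(\<lambda>k. (\<Sum>i<N. inner (x k) (B (e i)) * expectation (\<lambda>u. DH i (\<lambda>i. u (e i)))) - expectation (\<lambda>u. g u * h u)) \<longlonglongrightarrow> 0"
    by simp
  moreover have "(\<lambda>k. (\<Sum>i<N. inner (x k) (B (e i)) * expectation (\<lambda>u. DH i (\<lambda>i. u (e i)))) - expectation (\<lambda>u. g u * h u))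
    \<longlonglongrightarrow> (\<Sum>i<N. inner f (B (e i)) * expectation (\<lambda>u. DH i (\<lambda>i. u (e i)))) - expectation (\<lambda>u. g u * h u)"
    by (intro tendsto_intros x(2))
  ultimately show ?thesis
    using LIMSEQ_unique by (fastforce simp: h_def)
qed

end

section \<open>Smooth cylindrical functions\<close>

text \<open>The second difference over a square of side \<open>h k\<close> is computed in both
  orders with the mean value theorem, which gives equal values of the two mixed derivatives at
  points of the square. Continuity passes this to the corner \<open>(a, b)\<close>.\<close>

lemma mixed_partials_commute:
  fixes f fx fy fxy fyx :: "real \<Rightarrow> real \<Rightarrow> real"
  assumes D: "\<And>s t. ((\<lambda>s. f s t) has_real_derivative fx s t) (at s)"
      "\<And>s t. ((\<lambda>t. f s t) has_real_derivative fy s t) (at t)"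
      "\<And>s t. ((\<lambda>t. fx s t) has_real_derivative fxy s t) (at t)"
      "\<And>s t. ((\<lambda>s. fy s t) has_real_derivative fyx s t) (at s)"
    and cont: "continuous_on UNIV (\<lambda>p. fxy (fst p) (snd p))" "continuous_on UNIV (\<lambda>p. fyx (fst p) (snd p))"
  shows "fxy a b = fyx a b"
proof -
  define h where "h k = 1 / real (Suc k)" for k
  have h: "h k > 0" for k by (simp add: h_def)
  have h_lim: "h \<longlonglongrightarrow> 0" unfolding h_def by (rule LIMSEQ_Suc[OF lim_1_over_n])
  have "\<exists>p q. \<bar>fst p - a\<bar> \<le> h k \<and> \<bar>snd p - b\<bar> \<le> h k \<and> \<bar>fst q - a\<bar> \<le> h k \<and> \<bar>snd q - b\<bar> \<le> h k \<and>
      fxy (fst p) (snd p) = fyx (fst q) (snd q)" for k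
  proof -
    define \<Delta> where "\<Delta> = f (a + h k) (b + h k) - f (a + h k) b - f a (b + h k) + f a b"
    obtain s where s: "\<bar>s - a\<bar> \<le> \<bar>h k\<bar>" "\<Delta> = h k * (fx s (b + h k) - fx s b)"
      using real_mean_value[of "\<lambda>s. f s (b + h k) - f s b" "\<lambda>s. fx s (b + h k) - fx s b" a "h k", OF DERIV_diff[OF D(1) D(1)]]
      by (auto simp: \<Delta>_def algebra_simps)
    obtain t where t: "\<bar>t - b\<bar> \<le> \<bar>h k\<bar>" "fx s (b + h k) - fx s b = h k * fxy s t"
      using real_mean_value[of "fx s" "fxy s" b "h k", OF D(3)] by auto
    obtain t' where t': "\<bar>t' - b\<bar> \<le> \<bar>h k\<bar>" "\<Delta> = h k * (fy (a + h k) t' - fy a t')"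
      using real_mean_value[of "\<lambda>t. f (a + h k) t - f a t" "\<lambda>t. fy (a + h k) t - fy a t" b "h k", OF DERIV_diff[OF D(2) D(2)]]
      by (auto simp: \<Delta>_def algebra_simps)
    obtain s' where s': "\<bar>s' - a\<bar> \<le> \<bar>h k\<bar>" "fy (a + h k) t' - fy a t' = h k * fyx s' t'"
      using real_mean_value[of "\<lambda>s. fy s t'" "\<lambda>s. fyx s t'" a "h k", OF D(4)] by auto
    have "h k * (h k * fxy s t) = h k * (h k * fyx s' t')"
      using s(2) t'(2) unfolding t(2) s'(2) by (rule trans[OF sym])
    then have "fxy s t = fyx s' t'" using h[of k] by simp
    then show ?thesis
      using s t t' s' h[of k] by (intro exI[of _ "(s, t)"] exI[of _ "(s', t')"]) auto
  qed
  then obtain p q where pq: "\<And>k. \<bar>fst (p k) - a\<bar> \<le> h k" "\<And>k. \<bar>snd (p k) - b\<bar> \<le> h k"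
      "\<And>k. \<bar>fst (q k) - a\<bar> \<le> h k" "\<And>k. \<bar>snd (q k) - b\<bar> \<le> h k"
      "\<And>k. fxy (fst (p k)) (snd (p k)) = fyx (fst (q k)) (snd (q k))"
    by metis
  have lim: "r \<longlonglongrightarrow> c" if "\<And>k. \<bar>r k - c\<bar> \<le> h k" for r c
  proof -
    have "(\<lambda>k. r k - c) \<longlonglongrightarrow> 0"
      by (rule Lim_null_comparison[OF _ h_lim]) (simp add: that)
    then show ?thesis by (simp add: LIM_zero_iff)
  qed
  have "p \<longlonglongrightarrow> (a, b)" "q \<longlonglongrightarrow> (a, b)"
    using tendsto_Pair[OF lim[OF pq(1)] lim[OF pq(2)]] tendsto_Pair[OF lim[OF pq(3)] lim[OF pq(4)]] by simp_all
  then have "(\<lambda>k. fxy (fst (p k)) (snd (p k))) \<longlonglongrightarrow> fxy a b" "(\<lambda>k. fyx (fst (q k)) (snd (q k))) \<longlonglongrightarrow> fyx a b"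
    using continuous_on_tendsto_compose[OF cont(1), of p "(a, b)"] continuous_on_tendsto_compose[OF cont(2), of q "(a, b)"]
    by auto
  then show ?thesis
    unfolding pq(5) by (rule LIMSEQ_unique)
qed

text \<open>\<open>smooth_compact_support\<close> constrains a function on
  \<open>Euclidean_space n\<close> only. Composition with this projection gives a function of all
  sequences that is controlled everywhere.\<close>

definition truncate_seq :: "nat \<Rightarrow> (nat \<Rightarrow> real) \<Rightarrow> nat \<Rightarrow> real" where
  "truncate_seq n y = (\<lambda>i. if i < n then y i else 0)"

lemma truncate_seq_upd: "i < n \<Longrightarrow> truncate_seq n (y(i := t)) = (truncate_seq n y)(i := t)"
  by (auto simp: truncate_seq_def)

lemma truncate_seq_in_space: "truncate_seq n y \<in> topspace (Euclidean_space n)"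
  by (simp add: topspace_Euclidean_space truncate_seq_def)

lemma continuous_on_truncate_seq: "continuous_on UNIV (truncate_seq n)"
proof (rule continuous_on_coordinatewise_then_product)
  fix i
  show "continuous_on UNIV (\<lambda>x. truncate_seq n x i)"
    by (cases "i < n") (simp_all add: truncate_seq_def)
qed

lemma coords_eq_truncate_seq: "coords e n u = truncate_seq n (\<lambda>i. u (e i))"
  by (simp add: coords_def truncate_seq_def)

context
  fixes n :: nat and \<phi> :: "(nat \<Rightarrow> real) \<Rightarrow> real"
  assumes smooth: "smooth_compact_support n \<phi>"
begin

lemma smooth_continuous:
  assumes "set is \<subseteq> {..<n}"
  shows "continuous_on UNIV (\<lambda>y. fold partial is \<phi> (truncate_seq n y))"
proof -
  have "continuous_on (topspace (Euclidean_space n)) (fold partial is \<phi>)"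
    using smooth assms unfolding smooth_compact_support_def continuous_map_Euclidean_space_iff by blast
  then show ?thesis
    by (rule continuous_on_compose2[OF _ continuous_on_truncate_seq]) (auto simp: truncate_seq_in_space)
qed

lemma smooth_partial:
  assumes "set is \<subseteq> {..<n}" "i < n"
  shows "((\<lambda>t. fold partial is \<phi> (truncate_seq n (y(i := t)))) has_real_derivative
     partial i (fold partial is \<phi>) (truncate_seq n y)) (at (y i))"
proof -
  have "(\<lambda>t. fold partial is \<phi> ((truncate_seq n y)(i := t))) differentiable at (truncate_seq n y i)"
    using smooth assms truncate_seq_in_space unfolding smooth_compact_support_def by blast
  then show ?thesis
    using assms(2) by (simp add: partial_def truncate_seq_upd truncate_seq_def[of n y] DERIV_deriv_iff_real_differentiable)
qed

text \<open>One \<open>R\<close> serves all iterated derivatives: where a function vanishes on an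
  open set, so do its derivatives.\<close>

lemma smooth_box_supported:
  obtains R where "\<And>is. set is \<subseteq> {..<n} \<Longrightarrow> box_supported n R (\<lambda>y. fold partial is \<phi> (truncate_seq n y))"
proof -
  let ?K = "Euclidean_space n closure_of {x \<in> topspace (Euclidean_space n). \<phi> x \<noteq> 0}"
  have K: "compactin (Euclidean_space n) ?K"
    using smooth by (simp add: smooth_compact_support_def)
  then have "compact ?K"
    unfolding Euclidean_space_def compactin_subtopology euclidean_product_topology by simp
  have "\<exists>r. \<forall>x\<in>?K. \<bar>x i\<bar> \<le> r" for i
  proof -
    have c: "compact ((\<lambda>x. x i) ` ?K)"
      using \<open>compact ?K\<close> by (intro compact_continuous_image) (auto intro: continuous_on_subset[OF continuous_on_product_coordinates])
    show ?thesis
      using compact_imp_bounded[OF c] by (simp add: bounded_iff)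
  qed
  then obtain r where r: "\<And>i x. x \<in> ?K \<Longrightarrow> \<bar>x i\<bar> \<le> r i" by metis
  define R where "R = (\<Sum>i<n. \<bar>r i\<bar>)"
  have supp: "\<phi> (truncate_seq n y) = 0" if "i < n" "\<bar>y i\<bar> > R" for i y
  proof (rule ccontr)
    assume "\<phi> (truncate_seq n y) \<noteq> 0"
    then have "truncate_seq n y \<in> ?K"
      using closure_of_subset[of "{x \<in> topspace (Euclidean_space n). \<phi> x \<noteq> 0}" "Euclidean_space n"] truncate_seq_in_space by auto
    then have "\<bar>y i\<bar> \<le> \<bar>r i\<bar>" using r[of "truncate_seq n y" i] that by (simp add: truncate_seq_def)
    also have "\<dots> \<le> R" unfolding R_def using that by (intro member_le_sum) auto
    finally show False using that by simp
  qed
  have "fold partial is \<phi> (truncate_seq n y) = 0" if "set is \<subseteq> {..<n}" "i < n" "\<bar>y i\<bar> > R" for "is" i y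
    using that
  \<comment> \<open>\<open>fold\<close> applies the last index outermost, so the induction removes
    it first.\<close>
  proof (induction "is" arbitrary: y rule: rev_induct)
    case Nil
    then show ?case by (simp add: supp)
  next
    case (snoc j "is")
    let ?f = "\<lambda>t. fold partial is \<phi> (truncate_seq n (y(j := t)))"
    \<comment> \<open>Moving coordinate \<open>j\<close> slightly stays where the inner derivative
      vanishes: by openness if \<open>j = i\<close>, otherwise because coordinate \<open>i\<close>
      is untouched.\<close>
    have "\<forall>\<^sub>F t in nhds (y j). \<bar>(y(j := t)) i\<bar> > R"
    proof (cases "j = i")
      case True
      have "open {t :: real. R < \<bar>t\<bar>}" by (intro open_Collect_less continuous_intros)
      then have "\<forall>\<^sub>F t in nhds (y i). t \<in> {t. R < \<bar>t\<bar>}"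
        using snoc.prems(3) by (intro eventually_nhds_in_open) auto
      then show ?thesis by (simp add: True)
    qed (use snoc.prems in simp)
    then have "\<forall>\<^sub>F t in nhds (y j). ?f t = 0"
    proof (rule eventually_mono)
      fix t assume "\<bar>(y(j := t)) i\<bar> > R"
      then show "?f t = 0" using snoc.prems by (intro snoc.IH) auto
    qed
    then have "(?f has_real_derivative 0) (at (y j)) = ((\<lambda>_. 0) has_real_derivative 0) (at (y j))"
      by (intro DERIV_cong_ev) auto
    then have "(?f has_real_derivative 0) (at (y j))" by simp
    with smooth_partial[of "is" j y] show ?case
      using snoc.prems(1) by (auto dest: DERIV_unique)
  qed
  then have "box_supported n R (\<lambda>y. fold partial is \<phi> (truncate_seq n y))" if "set is \<subseteq> {..<n}" for "is"
    using that smooth_continuous[OF that] unfolding box_supported_def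
    by (auto simp: truncate_seq_def intro!: arg_cong[where f = "fold partial is \<phi>"])
  then show thesis using that by blast
qed

text \<open>The two-dimensional statement is applied on the plane through \<open>y\<close> in the
  directions of coordinates \<open>i\<close> and \<open>j\<close>.\<close>

lemma smooth_partials_commute:
  assumes i: "i < n" and j: "j < n"
  shows "partial i (partial j \<phi>) (truncate_seq n y) = partial j (partial i \<phi>) (truncate_seq n y)"
proof (cases "i = j")
  case False
  define z where "z s t = y(i := s, j := t)" for s t
  have z: "z s' t = (z s t)(i := s')" "z s t' = (z s t)(j := t')" "z s t i = s" "z s t j = t" for s s' t t'
    using False by (auto simp: z_def)
  have D: "((\<lambda>s. fold partial is \<phi> (truncate_seq n (z s t))) has_real_derivative
      partial i (fold partial is \<phi>) (truncate_seq n (z s t))) (at s)"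
      "((\<lambda>t. fold partial is \<phi> (truncate_seq n (z s t))) has_real_derivative
      partial j (fold partial is \<phi>) (truncate_seq n (z s t))) (at t)" if "set is \<subseteq> {..<n}" for s t "is"
    using smooth_partial[OF that i, of "z s t"] smooth_partial[OF that j, of "z s t"]
    by (simp_all add: z(1)[of _ t s, symmetric] z(2)[of s _ t, symmetric] z(3,4))
  have z_cont: "continuous_on UNIV (\<lambda>p. z (fst p) (snd p))"
  proof (rule continuous_on_coordinatewise_then_product)
    show "continuous_on UNIV (\<lambda>p. z (fst p) (snd p) k)" for k
      by (cases "k = j"; cases "k = i") (simp_all add: z_def continuous_on_fst continuous_on_snd)
  qed
  have cont: "continuous_on UNIV (\<lambda>p. fold partial is \<phi> (truncate_seq n (z (fst p) (snd p))))"
    if "set is \<subseteq> {..<n}" for "is"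
    by (rule continuous_on_compose2[OF smooth_continuous[OF that] z_cont]) simp
  \<comment> \<open>\<open>fold partial [i, j]\<close> differentiates in \<open>i\<close> first, so
    the lists \<open>[i, j]\<close> and \<open>[j, i]\<close> give the two mixed
    derivatives.\<close>
  have "partial j (partial i \<phi>) (truncate_seq n (z (y i) (y j))) = partial i (partial j \<phi>) (truncate_seq n (z (y i) (y j)))"
    by (rule mixed_partials_commute[of
        "\<lambda>s t. \<phi> (truncate_seq n (z s t))" "\<lambda>s t. partial i \<phi> (truncate_seq n (z s t))"
        "\<lambda>s t. partial j \<phi> (truncate_seq n (z s t))"])
      (use D[of "[]"] D[of "[i]"] D[of "[j]"] cont[of "[i, j]"] cont[of "[j, i]"] i j in auto)
  moreover have "z (y i) (y j) = y" by (simp add: z_def)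
  ultimately show ?thesis by simp
qed simp

end

lemma box_supported_mult:
  assumes F: "box_supported n R F" and G: "box_supported m R' G"
  shows "box_supported (max n m) (max R R') (\<lambda>y. F y * G y)"
  using assms unfolding box_supported_def
  by (auto simp: less_max_iff_disj intro!: continuous_intros arg_cong2[where f = "(*)"])

section \<open>The KMS condition\<close>

lemma evaluation_borel_measurable:
  assumes \<mu>: "sets \<mu> = sets (borel_of (weak_star_topology V ip))" and v: "v \<in> V"
  shows "(\<lambda>u. u v) \<in> borel_measurable \<mu>"
proof (rule borel_measurableI)
  let ?T = "weak_star_topology V ip"
  have sets: "sets (borel_of ?T) = sigma_sets (topspace ?T) {U. openin ?T U}"
    unfolding borel_of_def by (intro sets_measure_of) (auto dest: openin_subset)
  have space: "space \<mu> = topspace ?T"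
    using sets_eq_imp_space_eq[OF \<mu>] by (simp add: borel_of_def space_measure_of_conv)
  fix S :: "real set" assume "open S"
  moreover have "continuous_map ?T euclideanreal (\<lambda>u. u v)"
    unfolding weak_star_topology_def using v
    by (intro continuous_map_from_subtopology continuous_map_product_projection)
  ultimately have "openin ?T {u \<in> topspace ?T. u v \<in> S}"
    by (simp add: openin_continuous_map_preimage)
  moreover have "(\<lambda>u. u v) -` S \<inter> space \<mu> = {u \<in> topspace ?T. u v \<in> S}"
    by (auto simp: space)
  ultimately show "(\<lambda>u. u v) -` S \<inter> space \<mu> \<in> sets \<mu>"
    unfolding \<mu> sets by (auto intro: sigma_sets.Basic)
qed

text \<open>With this, continuity of \<open>J\<close> for the countably normed topology also says
  that \<open>J\<close> maps \<open>Phi\<close> into itself.\<close>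

lemma topspace_countably_normed_topology:
  assumes "countably_Hilbert_nuclear V ip"
  shows "topspace (countably_normed_topology V ip) = V"
proof -
  have "x \<in> \<Union>{B. \<exists>n. \<exists>x\<in>V. \<exists>\<epsilon>>0. B = {y \<in> V. ip_norm (ip n) (y - x) < \<epsilon>}}" if x: "x \<in> V" for x
  proof -
    have "inner_product_on V (ip 0)" "0 \<in> V"
      using assms subspace_0 by (auto simp: countably_Hilbert_nuclear_def)
    then have "ip 0 (0 *\<^sub>R 0) 0 = 0 * ip 0 0 0"
      unfolding inner_product_on_def by blast
    then have "ip_norm (ip 0) (x - x) < 1" by (simp add: ip_norm_def)
    with x have "x \<in> {y \<in> V. ip_norm (ip 0) (y - x) < 1}" by simp
    moreover have "\<exists>n. \<exists>z\<in>V. \<exists>\<epsilon>>0. {y \<in> V. ip_norm (ip 0) (y - x) < 1} = {y \<in> V. ip_norm (ip n) (y - z) < \<epsilon>}"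
      using x zero_less_one by blast
    ultimately show ?thesis by blast
  qed
  then show ?thesis
    unfolding countably_normed_topology_def topology_generated_by_topspace by auto
qed

lemma sum_skew_symmetric_eq_0:
  fixes a S :: "nat \<Rightarrow> nat \<Rightarrow> real"
  assumes "\<And>i j. a i j = - a j i" and "\<And>i j. i < n \<Longrightarrow> j < n \<Longrightarrow> S i j = S j i"
  shows "(\<Sum>j<n. \<Sum>i<n. a j i * S j i) = 0"
proof -
  have "(\<Sum>j<n. \<Sum>i<n. a j i * S j i) = (\<Sum>i<n. \<Sum>j<n. a j i * S j i)" by (rule sum.swap)
  also have "\<dots> = (\<Sum>i<n. \<Sum>j<n. - (a i j * S i j))"
  proof (intro sum.cong refl)
    fix i j assume "i \<in> {..<n}" "j \<in> {..<n}"
    then show "a j i * S j i = - (a i j * S i j)" using assms(1)[of j i] assms(2)[of j i] by simp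
  qed
  finally show ?thesis by (simp add: sum_negf)
qed

lemma box_supported_add:
  "box_supported N R F \<Longrightarrow> box_supported N R G \<Longrightarrow> box_supported N R (\<lambda>y. F y + G y)"
  unfolding box_supported_def by (auto intro!: continuous_intros arg_cong2[where f = "(+)"])

lemma box_supported_zero: "box_supported N R (\<lambda>_. 0)"
  by (simp add: box_supported_def)

section \<open>Integration by parts for test functions and the Poisson bracket\<close>

context gaussian_functionals
begin

text \<open>The product rule splits the derivative into the two sums. As the factors depend on
  different numbers of coordinates, integration by parts is used in \<open>max n m\<close> variables
  and each sum is cut back afterwards.\<close>

lemma integral_L2_pairing_partial:
  assumes dense: "closure V = UNIV" and g: "is_L2_pairing V M f g" and e: "\<And>i. e i \<in> V"
    and \<phi>: "smooth_compact_support n \<phi>" and \<psi>: "smooth_compact_support m \<psi>" and j: "j < n"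
  shows "integrable M (\<lambda>u. g u * (partial j \<phi> (coords e n u) * \<psi> (coords e m u)))"
    "expectation (\<lambda>u. g u * (partial j \<phi> (coords e n u) * \<psi> (coords e m u))) =
      (\<Sum>i<n. inner f (B (e i)) * expectation (\<lambda>u. partial i (partial j \<phi>) (coords e n u) * \<psi> (coords e m u))) +
      (\<Sum>i<m. inner f (B (e i)) * expectation (\<lambda>u. partial j \<phi> (coords e n u) * partial i \<psi> (coords e m u)))"
proof -
  obtain R where R: "\<And>is. set is \<subseteq> {..<n} \<Longrightarrow> box_supported n R (\<lambda>y. fold partial is \<phi> (truncate_seq n y))"
    using smooth_box_supported[OF \<phi>] by blast
  obtain R' where R': "\<And>is. set is \<subseteq> {..<m} \<Longrightarrow> box_supported m R' (\<lambda>y. fold partial is \<psi> (truncate_seq m y))"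
    using smooth_box_supported[OF \<psi>] by blast
  define F where "F y = partial j \<phi> (truncate_seq n y)" for y
  define G where "G y = \<psi> (truncate_seq m y)" for y
  \<comment> \<open>\<open>truncate_seq\<close> ignores the coordinates from \<open>n\<close> on, so
    the derivative of \<open>F\<close> in them is 0.\<close>
  define DF where "DF i y = (if i < n then partial i (partial j \<phi>) (truncate_seq n y) else 0)" for i y
  define DG where "DG i y = (if i < m then partial i \<psi> (truncate_seq m y) else 0)" for i y
  let ?N = "max n m" and ?R = "max R R'"
  have F: "box_supported n R F" unfolding F_def using R[of "[j]"] j by simp
  have G: "box_supported m R' G" unfolding G_def using R'[of "[]"] by simp
  have DF: "box_supported n R (DF i)" for i
    using R[of "[j, i]"] j box_supported_zero unfolding DF_def by (cases "i < n") auto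
  have DG: "box_supported m R' (DG i)" for i
    using R'[of "[i]"] box_supported_zero unfolding DG_def by (cases "i < m") auto
  have FG: "box_supported ?N ?R (\<lambda>y. F y * G y)" by (rule box_supported_mult[OF F G])
  have DFG: "box_supported ?N ?R (\<lambda>y. DF i y * G y)" for i by (rule box_supported_mult[OF DF G])
  have FDG: "box_supported ?N ?R (\<lambda>y. F y * DG i y)" for i by (rule box_supported_mult[OF F DG])
  have dF: "((\<lambda>t. F (y(i := t))) has_real_derivative DF i y) (at (y i))" for i y
  proof (cases "i < n")
    case True
    then show ?thesis using smooth_partial[OF \<phi>, of "[j]" i y] j by (simp add: F_def DF_def)
  next
    case False
    then have "truncate_seq n (y(i := t)) = truncate_seq n y" for t by (auto simp: truncate_seq_def)
    then show ?thesis using False by (simp add: F_def DF_def)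
  qed
  have dG: "((\<lambda>t. G (y(i := t))) has_real_derivative DG i y) (at (y i))" for i y
  proof (cases "i < m")
    case True
    then show ?thesis using smooth_partial[OF \<psi>, of "[]" i y] by (simp add: G_def DG_def)
  next
    case False
    then have "truncate_seq m (y(i := t)) = truncate_seq m y" for t by (auto simp: truncate_seq_def)
    then show ?thesis using False by (simp add: G_def DG_def)
  qed
  have deriv: "((\<lambda>t. F (y(i := t)) * G (y(i := t))) has_real_derivative DF i y * G y + F y * DG i y) (at (y i))" for i y
    using DERIV_mult[OF dF[of y i] dG[of y i]] by (simp add: mult.commute)
  have g_int: "integrable M g"
    using g unfolding is_L2_pairing_def by (elim conjE) (rule square_integrable_imp_integrable)
  show "integrable M (\<lambda>u. g u * (partial j \<phi> (coords e n u) * \<psi> (coords e m u)))"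
    using integrable_mult_box_supported[OF g_int e FG] by (simp add: F_def G_def coords_eq_truncate_seq)
  let ?Y = "\<lambda>u i. u (e i)"
  have int: "integrable M (\<lambda>u. DF i (?Y u) * G (?Y u))" "integrable M (\<lambda>u. F (?Y u) * DG i (?Y u))" for i
    using integrable_mult_box_supported[of "\<lambda>_. 1", OF _ e DFG] integrable_mult_box_supported[of "\<lambda>_. 1", OF _ e FDG]
    by simp_all
  have "expectation (\<lambda>u. g u * (F (?Y u) * G (?Y u))) =
      (\<Sum>i<?N. inner f (B (e i)) * expectation (\<lambda>u. DF i (?Y u) * G (?Y u) + F (?Y u) * DG i (?Y u)))"
    by (rule integration_by_parts_L2_pairing[OF dense g e FG _ deriv]) (rule box_supported_add[OF DFG FDG])
  also have "\<dots> = (\<Sum>i<?N. inner f (B (e i)) * expectation (\<lambda>u. DF i (?Y u) * G (?Y u)))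
      + (\<Sum>i<?N. inner f (B (e i)) * expectation (\<lambda>u. F (?Y u) * DG i (?Y u)))"
    using int by (simp add: distrib_left sum.distrib)
  also have "(\<Sum>i<?N. inner f (B (e i)) * expectation (\<lambda>u. DF i (?Y u) * G (?Y u))) =
      (\<Sum>i<n. inner f (B (e i)) * expectation (\<lambda>u. DF i (?Y u) * G (?Y u)))"
    by (rule sum.mono_neutral_right) (auto simp: DF_def)
  also have "(\<Sum>i<?N. inner f (B (e i)) * expectation (\<lambda>u. F (?Y u) * DG i (?Y u))) =
      (\<Sum>i<m. inner f (B (e i)) * expectation (\<lambda>u. F (?Y u) * DG i (?Y u)))"
    by (rule sum.mono_neutral_right) (auto simp: DG_def)
  finally show "expectation (\<lambda>u. g u * (partial j \<phi> (coords e n u) * \<psi> (coords e m u))) =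
      (\<Sum>i<n. inner f (B (e i)) * expectation (\<lambda>u. partial i (partial j \<phi>) (coords e n u) * \<psi> (coords e m u))) +
      (\<Sum>i<m. inner f (B (e i)) * expectation (\<lambda>u. partial j \<phi> (coords e n u) * partial i \<psi> (coords e m u)))"
    by (simp add: F_def G_def DF_def DG_def coords_eq_truncate_seq)
qed

lemma expectation_poisson:
  assumes e: "\<And>i. e i \<in> V" and J: "linear J"
    and \<phi>: "smooth_compact_support n \<phi>" and \<psi>: "smooth_compact_support m \<psi>"
  shows "expectation (poisson J e n \<phi> m \<psi>) = (\<Sum>j<n. \<Sum>i<m. inner (e j) (J (e i)) *
      expectation (\<lambda>u. partial j \<phi> (coords e n u) * partial i \<psi> (coords e m u)))"
proof -
  obtain R where R: "\<And>is. set is \<subseteq> {..<n} \<Longrightarrow> box_supported n R (\<lambda>y. fold partial is \<phi> (truncate_seq n y))"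
    using smooth_box_supported[OF \<phi>] by blast
  obtain R' where R': "\<And>is. set is \<subseteq> {..<m} \<Longrightarrow> box_supported m R' (\<lambda>y. fold partial is \<psi> (truncate_seq m y))"
    using smooth_box_supported[OF \<psi>] by blast
  have int: "integrable M (\<lambda>u. partial j \<phi> (coords e n u) * partial i \<psi> (coords e m u))" if "j < n" "i < m" for i j
    using integrable_mult_box_supported[of "\<lambda>_. 1", OF _ e box_supported_mult[OF R[of "[j]"] R'[of "[i]"]]] that
    by (simp add: coords_eq_truncate_seq)
  have "poisson J e n \<phi> m \<psi> u = (\<Sum>j<n. \<Sum>i<m. inner (e j) (J (e i)) *
      (partial j \<phi> (coords e n u) * partial i \<psi> (coords e m u)))" for u
    using J by (subst sum.swap) (simp add: poisson_def cyl_grad_def linear_sum linear_scale inner_sum_left inner_sum_right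
        sum_distrib_left mult_ac)
  then have "expectation (poisson J e n \<phi> m \<psi>) = expectation (\<lambda>u. \<Sum>j<n. \<Sum>i<m. inner (e j) (J (e i)) *
      (partial j \<phi> (coords e n u) * partial i \<psi> (coords e m u)))"
    by (rule Bochner_Integration.integral_cong[OF refl])
  also have "\<dots> = (\<Sum>j<n. \<Sum>i<m. expectation (\<lambda>u. inner (e j) (J (e i)) *
      (partial j \<phi> (coords e n u) * partial i \<psi> (coords e m u))))"
    using int by (subst Bochner_Integration.integral_sum;
        (intro sum.cong refl Bochner_Integration.integral_sum Bochner_Integration.integrable_sum integrable_mult_right)?) auto
  finally show ?thesis by simp
qed

text \<open>The assumption \<open>cov\<close> is the only link between \<open>A\<close> and the
  measure: for \<open>B\<close> the inverse of \<open>A\<close> divided by \<open>\<beta>\<close>,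
  both \<open>A\<close> and \<open>\<beta>\<close> cancel and the symplectic matrix remains.\<close>

lemma kms_identity:
  assumes dense: "closure V = UNIV" and e: "\<And>i. e i \<in> V" and J: "linear J"
    and skew: "\<And>u v. inner u (J v) = - inner v (J u)"
    and cov: "\<And>v w. v \<in> V \<Longrightarrow> w \<in> V \<Longrightarrow> \<beta> * inner (A (J v)) (B w) = inner (J v) w"
    and \<phi>: "smooth_compact_support n \<phi>" and \<psi>: "smooth_compact_support m \<psi>"
  shows "expectation (poisson J e n \<phi> m \<psi>) =
    \<beta> * expectation (\<lambda>u. grad_field_pairing (JA_field V M J A) e n \<phi> u * cyl e m \<psi> u)"
proof -
  define g where "g j = L2_pairing V M (A (J (e j)))" for j
  have g: "is_L2_pairing V M (A (J (e j))) (g j)" for j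
    unfolding g_def by (rule is_L2_pairing_L2_pairing[OF dense])
  define S where "S j i = expectation (\<lambda>u. partial i (partial j \<phi>) (coords e n u) * \<psi> (coords e m u))" for i j
  define P where "P j i = expectation (\<lambda>u. partial j \<phi> (coords e n u) * partial i \<psi> (coords e m u))" for i j
  define a where "a j i = inner (J (e j)) (e i)" for i j
  note ibp = integral_L2_pairing_partial[OF dense g e \<phi> \<psi>]
  have "\<beta> * expectation (\<lambda>u. grad_field_pairing (JA_field V M J A) e n \<phi> u * cyl e m \<psi> u) =
      \<beta> * expectation (\<lambda>u. - (\<Sum>j<n. g j u * (partial j \<phi> (coords e n u) * \<psi> (coords e m u))))"
    by (simp add: grad_field_pairing_def JA_field_def cyl_def g_def sum_distrib_left sum_distrib_right sum_negf mult_ac)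
  also have "\<dots> = - (\<Sum>j<n. \<beta> * expectation (\<lambda>u. g j u * (partial j \<phi> (coords e n u) * \<psi> (coords e m u))))"
    using ibp(1) by (simp add: Bochner_Integration.integral_sum sum_distrib_left)
  also have "\<dots> = - (\<Sum>j<n. (\<Sum>i<n. a j i * S j i) + (\<Sum>i<m. a j i * P j i))"
  proof -
    have "\<beta> * expectation (\<lambda>u. g j u * (partial j \<phi> (coords e n u) * \<psi> (coords e m u))) =
        (\<Sum>i<n. a j i * S j i) + (\<Sum>i<m. a j i * P j i)" if "j < n" for j
    proof -
      have *: "\<beta> * (inner (A (J (e j))) (B (e i)) * x) = a j i * x" for i x
        using cov[OF e e, of j i] by (simp add: a_def flip: mult.assoc)
      show ?thesis
        unfolding ibp(2)[OF that] distrib_left sum_distrib_left * S_def P_def ..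
    qed
    then show ?thesis by simp
  qed
  also have "\<dots> = - (\<Sum>j<n. \<Sum>i<n. a j i * S j i) - (\<Sum>j<n. \<Sum>i<m. a j i * P j i)"
    by (simp add: sum.distrib)
  \<comment> \<open>The Hessian of \<open>\<phi>\<close> is symmetric and \<open>a\<close> is skew,
    so the second-order terms cancel.\<close>
  also have "(\<Sum>j<n. \<Sum>i<n. a j i * S j i) = 0"
  proof (rule sum_skew_symmetric_eq_0)
    show "a i j = - a j i" for i j
      using skew[of "e j" "e i"] by (simp add: a_def inner_commute)
    show "S i j = S j i" if "i < n" "j < n" for i j
      unfolding S_def coords_eq_truncate_seq using smooth_partials_commute[OF \<phi> that] by simp
  qed
  \<comment> \<open>The skew symmetry of \<open>J\<close> absorbs the minus sign from the weak
    definition of the vector field.\<close>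
  also have "(\<Sum>j<n. \<Sum>i<m. a j i * P j i) = - (\<Sum>j<n. \<Sum>i<m. inner (e j) (J (e i)) * P j i)"
  proof -
    have "a j i = - inner (e j) (J (e i))" for i j
      using skew[of "e j" "e i"] by (simp add: a_def inner_commute)
    then show ?thesis by (simp add: sum_negf)
  qed
  finally show ?thesis
    unfolding expectation_poisson[OF e J \<phi> \<psi>] P_def by simp
qed

end

section \<open>Reduction to the abstract Gaussian setting\<close>

theorem theorem3p3:
  fixes Phi :: "'h::{real_inner, polish_space} set"
    and ip :: "nat \<Rightarrow> 'h \<Rightarrow> 'h \<Rightarrow> real"
    and \<sigma> :: "'h \<Rightarrow> 'h \<Rightarrow> real"
    and J A :: "'h \<Rightarrow> 'h"
    and D :: "'h set"
    and e :: "nat \<Rightarrow> 'h"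
    and \<beta> :: real
    and \<mu> :: "('h \<Rightarrow> real) measure"
  assumes "countably_Hilbert_nuclear Phi ip"
    and "closure Phi = UNIV"
    and "continuous_map (countably_normed_topology Phi ip) euclidean (\<lambda>x. x)"
    and "symplectic_form \<sigma>"
    and "bounded_linear J" and "\<forall>u v. \<sigma> u v = inner u (J v)"
    and "continuous_map (countably_normed_topology Phi ip) (countably_normed_topology Phi ip) J"
    and "positive_invertible_operator D A" and "Phi \<subseteq> D"
    and "range e \<subseteq> Phi" and "inj e" and "independent (range e)"
    and "closure (span (range e)) = UNIV"
    and "\<beta> > 0"
    and "borel_prob_on_dual Phi ip \<mu>"
    and "\<forall>v\<in>Phi. (\<integral>u. exp (\<i> * complex_of_real (u v)) \<partial>\<mu>) =
           complex_of_real (exp (- (1 / (2 * \<beta>)) * inner v (inv_into D A v)))"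
  shows "kms_state Phi ip J e \<beta> (JA_field Phi \<mu> J A) \<mu>"
proof -
  note nuclear = assms(1) and dense = assms(2) and pos = assms(8) and \<beta> = assms(14)
  have \<mu>: "prob_space \<mu>" "sets \<mu> = sets (borel_of (weak_star_topology Phi ip))"
    using assms(15) by (auto simp: borel_prob_on_dual_def)
  have subspace: "subspace Phi"
    using nuclear by (simp add: countably_Hilbert_nuclear_def)
  have e: "e i \<in> Phi" for i using assms(10) by auto
  have J_Phi: "J v \<in> Phi" if "v \<in> Phi" for v
    using continuous_map_funspace[OF assms(7)] that by (auto simp: topspace_countably_normed_topology[OF nuclear])
  have skew: "inner u (J v) = - inner v (J u)" for u v
    using assms(4,6) unfolding symplectic_form_def by metis
  have bij: "bij_betw A D UNIV" and inv_bl: "bounded_linear (inv_into D A)"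
    and A_sym: "\<And>x y. x \<in> D \<Longrightarrow> y \<in> D \<Longrightarrow> inner (A x) y = inner x (A y)"
    using pos by (auto simp: positive_invertible_operator_def)
  obtain c where c: "c > 0" "\<And>x. x \<in> D \<Longrightarrow> c * inner x x \<le> inner x (A x)"
    using pos by (auto simp: positive_invertible_operator_def)
  have inv_D: "inv_into D A x \<in> D" and A_inv: "A (inv_into D A x) = x" for x
    using bij by (auto simp: bij_betw_def intro: inv_into_into f_inv_into_f)
  have inv_A: "inv_into D A (A x) = x" if "x \<in> D" for x
    using bij that by (simp add: bij_betw_def)
  \<comment> \<open>With this scaling \<open>- (inner v (B v) / 2)\<close> is the exponent of the
    given characteristic function.\<close>
  define B where "B x = (1 / \<beta>) *\<^sub>R inv_into D A x" for x
  \<comment> \<open>Symmetry of \<open>A\<close> is used at the preimages of \<open>x\<close> and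
    \<open>y\<close>.\<close>
  have inv_sym: "inner (inv_into D A x) y = inner x (inv_into D A y)" for x y
    using A_sym[OF inv_D inv_D, of x y] by (simp add: A_inv)
  interpret gaussian_functionals \<mu> Phi B
  proof (intro gaussian_functionals.intro gaussian_functionals_axioms.intro \<mu>(1) subspace)
    have space: "space \<mu> \<subseteq> dual_space Phi ip"
      using sets_eq_imp_space_eq[OF \<mu>(2)] by (auto simp: borel_of_def space_measure_of_conv weak_star_topology_def)
    then show "u (x + y) = u x + u y" if "u \<in> space \<mu>" "x \<in> Phi" "y \<in> Phi" for u x y
      using that by (auto simp: dual_space_def)
    show "u (r *\<^sub>R x) = r * u x" if "u \<in> space \<mu>" "x \<in> Phi" for u x r
      using that space by (auto simp: dual_space_def)
    show "(\<lambda>u. u v) \<in> borel_measurable \<mu>" if "v \<in> Phi" for v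
      by (rule evaluation_borel_measurable[OF \<mu>(2) that])
    show "bounded_linear B"
      unfolding B_def[abs_def] using inv_bl by (rule bounded_linear_compose[OF bounded_linear_scaleR_right])
    show "inner (B x) y = inner x (B y)" for x y
      by (simp add: B_def inv_sym)
    show "0 \<le> inner x (B x)" for x
    proof -
      \<comment> \<open>The lower bound on \<open>A\<close> at the preimage of \<open>x\<close>
        yields positivity of the covariance.\<close>
      have "0 \<le> c * inner (inv_into D A x) (inv_into D A x)" using c(1) by simp
      also have "\<dots> \<le> inner (inv_into D A x) x" using c(2)[OF inv_D, of x] by (simp add: A_inv)
      finally show ?thesis using \<beta> by (simp add: B_def inner_commute)
    qed
    show "(\<integral>u. exp (\<i> * complex_of_real (u v)) \<partial>\<mu>) = complex_of_real (exp (- (inner v (B v) / 2)))" if "v \<in> Phi" for v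
      using assms(16) that by (simp add: B_def field_simps)
  qed
  \<comment> \<open>Moving the inverse to the other factor cancels \<open>A\<close>, since
    \<open>J v\<close> lies in \<open>Phi\<close> and hence in \<open>D\<close>.\<close>
  have cov: "\<beta> * inner (A (J v)) (B w) = inner (J v) w" if "v \<in> Phi" "w \<in> Phi" for v w
    using inv_sym[of "A (J v)" w] inv_A[of "J v"] J_Phi[OF that(1)] assms(9) \<beta> by (auto simp: B_def)
  show ?thesis
    unfolding kms_state_def
  proof (intro conjI allI ballI impI)
    \<comment> \<open>The L2 pairing exists at every vector of the Hilbert space, so any
      \<open>f\<close> is allowed here.\<close>
    show "integrable \<mu> (JA_field Phi \<mu> J A f)" for f
    proof -
      have "integrable \<mu> (L2_pairing Phi \<mu> (A (J f)))"
        using is_L2_pairing_L2_pairing[OF dense, of "A (J f)"] unfolding is_L2_pairing_def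
        by (elim conjE) (rule square_integrable_imp_integrable)
      then show ?thesis by (simp add: JA_field_def[abs_def])
    qed
  qed (use assms(15) kms_identity[OF dense e bounded_linear.linear[OF assms(5)] skew cov] in auto)
qed

end
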